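(* Let $n\ge 1$. Every odd-dimensional irreducible complex representation of the hyperoctahedral group $\mathbb B_n$, when restricted to $\mathbb B_{n-1}$, contains exactly one odd-dimensional irreducible representation of $\mathbb B_{n-1}$.
   Context: The hyperoctahedral group is $\mathbb B_n=S_2\wr S_n=S_2^n\rtimes S_n$, with $\mathbb B_0$ the trivial group and $\mathbb B_{n-1}\subset\mathbb B_n$ embedded in the standard way, as $S_2^{n-1}\rtimes S_{n-1}$ acting on the first $n-1$ coordinates. *)

theory Defs
  imports Complex_Main "HOL-Algebra.Sym_Groups"
begin

section \<open>Hyperoctahedral groups\<close>

text \<open>
  The wreath product of \<open>G\<close> with the symmetric group on \<open>{1..n}\<close>. The normal factor consists of the
  families indexed by \<open>{1..n}\<close>, extended by the identity of \<open>G\<close> outside \<open>{1..n}\<close> (just as permutations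
  of \<open>{1..n}\<close> fix everything outside). With this convention the standard embedding of the
  \<open>m\<close>-th wreath product into the \<open>n\<close>-th one, for \<open>m \<le> n\<close>, is an inclusion of carriers.
  A permutation \<open>p\<close> acts on a family \<open>g\<close> by moving the entry at position \<open>i\<close> to position \<open>p i\<close>.
\<close>

definition wreath_sym ::
    "('a, 'b) monoid_scheme \<Rightarrow> nat \<Rightarrow> ((nat \<Rightarrow> 'a) \<times> (nat \<Rightarrow> nat)) monoid" where
  "wreath_sym G n =
     \<lparr> carrier = {f. (\<forall>i\<in>{1..n}. f i \<in> carrier G) \<and> (\<forall>i. i \<notin> {1..n} \<longrightarrow> f i = \<one>\<^bsub>G\<^esub>)}
                 \<times> carrier (sym_group n),
       mult = (\<lambda>(f, p) (g, q). (\<lambda>i. f i \<otimes>\<^bsub>G\<^esub> g (inv_into UNIV p i), p \<otimes>\<^bsub>sym_group n\<^esub> q)),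
       one = (\<lambda>i. \<one>\<^bsub>G\<^esub>, \<one>\<^bsub>sym_group n\<^esub>) \<rparr>"

definition hyperoctahedral :: "nat \<Rightarrow> ((nat \<Rightarrow> nat \<Rightarrow> nat) \<times> (nat \<Rightarrow> nat)) monoid" where
  "hyperoctahedral n = wreath_sym (sym_group 2) n"

lemma group_wreath_sym:
  fixes G (structure)
  assumes "group G"
  shows "group (wreath_sym G n)"
proof -
  interpret group G by fact
  have outside: "inv_into UNIV p i = i" if "p permutes {1..n}" "i \<notin> {1..n}" for p i
    using permutes_inv[OF that(1)] that(2) by (simp add: permutes_def)
  have clos: "f i \<in> carrier G"
    if "\<forall>i\<in>{1..n}. f i \<in> carrier G" "\<forall>i. i \<notin> {1..n} \<longrightarrow> f i = \<one>" for f :: "nat \<Rightarrow> 'a" and i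
    using that one_closed by (cases "i \<in> {1..n}") metis+
  show ?thesis
  proof (rule groupI)
    fix x y assume *: "x \<in> carrier (wreath_sym G n)" "y \<in> carrier (wreath_sym G n)"
    obtain f p g q where xy: "x = (f, p)" "y = (g, q)" by (metis surj_pair)
    have c: "f i \<in> carrier G" "g i \<in> carrier G" for i
      using * clos[of f] clos[of g] unfolding xy by (auto simp: wreath_sym_def)
    have p: "p permutes {1..n}" and q: "q permutes {1..n}"
      using * unfolding xy by (auto simp: wreath_sym_def sym_group_def)
    have "f i = \<one>" "g i = \<one>" if "i \<notin> {1..n}" for i
      using * that unfolding xy by (auto simp: wreath_sym_def)
    then have "f i \<otimes> g (inv_into UNIV p i) = \<one>" if "i \<notin> {1..n}" for i
      using outside[OF p that] that by simp
    then show "x \<otimes>\<^bsub>wreath_sym G n\<^esub> y \<in> carrier (wreath_sym G n)"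
      unfolding xy using c permutes_compose[OF q p]
      by (simp add: wreath_sym_def sym_group_def)
  next
    show "\<one>\<^bsub>wreath_sym G n\<^esub> \<in> carrier (wreath_sym G n)"
      by (auto simp: wreath_sym_def sym_group_def permutes_id)
  next
    fix x y z
    assume *: "x \<in> carrier (wreath_sym G n)" "y \<in> carrier (wreath_sym G n)"
      "z \<in> carrier (wreath_sym G n)"
    obtain f p g q h r where xyz: "x = (f, p)" "y = (g, q)" "z = (h, r)" by (metis surj_pair)
    have c: "f i \<in> carrier G" "g i \<in> carrier G" "h i \<in> carrier G" for i
      using * clos[of f] clos[of g] clos[of h] unfolding xyz by (auto simp: wreath_sym_def)
    have "bij p" "bij q"
      using * unfolding xyz by (auto simp: wreath_sym_def sym_group_def dest: permutes_bij)
    then show "x \<otimes>\<^bsub>wreath_sym G n\<^esub> y \<otimes>\<^bsub>wreath_sym G n\<^esub> z =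
        x \<otimes>\<^bsub>wreath_sym G n\<^esub> (y \<otimes>\<^bsub>wreath_sym G n\<^esub> z)"
      unfolding xyz by (simp add: wreath_sym_def sym_group_def o_inv_distrib m_assoc c comp_assoc)
  next
    fix x assume *: "x \<in> carrier (wreath_sym G n)"
    obtain f p where x: "x = (f, p)" by (metis surj_pair)
    have c: "f i \<in> carrier G" for i
      using * clos[of f] unfolding x by (auto simp: wreath_sym_def)
    show "\<one>\<^bsub>wreath_sym G n\<^esub> \<otimes>\<^bsub>wreath_sym G n\<^esub> x = x"
      unfolding x by (simp add: wreath_sym_def sym_group_def c)
    have p: "p permutes {1..n}"
      using * unfolding x by (simp add: wreath_sym_def sym_group_def)
    have f1: "f i = \<one>" if "i \<notin> {1..n}" for i
      using * that unfolding x by (auto simp: wreath_sym_def)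
    let ?y = "(\<lambda>i. inv (f (p i)), inv_into UNIV p)"
    have "?y \<in> carrier (wreath_sym G n)"
      using c f1 permutes_inv[OF p] p
      by (auto simp: wreath_sym_def sym_group_def permutes_def)
    moreover have "?y \<otimes>\<^bsub>wreath_sym G n\<^esub> x = \<one>\<^bsub>wreath_sym G n\<^esub>"
      unfolding x using c p
      by (simp add: wreath_sym_def sym_group_def permutes_inv_inv permutes_inv_o)
    ultimately show "\<exists>y\<in>carrier (wreath_sym G n). y \<otimes>\<^bsub>wreath_sym G n\<^esub> x = \<one>\<^bsub>wreath_sym G n\<^esub>"
      by blast
  qed
qed

lemma group_hyperoctahedral: "group (hyperoctahedral n)"
  unfolding hyperoctahedral_def by (intro group_wreath_sym sym_group_is_group)

lemma wreath_sym_restrict: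
  fixes G (structure)
  assumes "group G" and "m \<le> n"
  shows "(wreath_sym G n)\<lparr>carrier := carrier (wreath_sym G m)\<rparr> = wreath_sym G m"
    and "carrier (wreath_sym G m) \<subseteq> carrier (wreath_sym G n)"
proof -
  interpret group G by fact
  show "(wreath_sym G n)\<lparr>carrier := carrier (wreath_sym G m)\<rparr> = wreath_sym G m"
    by (simp add: wreath_sym_def sym_group_def)
  have sub: "{1..m} \<subseteq> {1..n}" using assms(2) by auto
  have "f i \<in> carrier G"
    if "\<forall>i\<in>{1..m}. f i \<in> carrier G" "\<forall>i. i \<notin> {1..m} \<longrightarrow> f i = \<one>" for f :: "nat \<Rightarrow> 'a" and i
    using that one_closed by (cases "i \<in> {1..m}") metis+
  moreover have "f i = \<one>"
    if "\<forall>i. i \<notin> {1..m} \<longrightarrow> f i = \<one>" "i \<notin> {1..n}" for f :: "nat \<Rightarrow> 'a" and i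
    using that sub by blast
  ultimately show "carrier (wreath_sym G m) \<subseteq> carrier (wreath_sym G n)"
    using permutes_subset[OF _ sub] unfolding wreath_sym_def sym_group_def
    by (simp add: Sigma_mono subset_iff)
qed

lemma subgroup_hyperoctahedral:
  assumes "m \<le> n"
  shows "subgroup (carrier (hyperoctahedral m)) (hyperoctahedral n)"
    and "(hyperoctahedral n)\<lparr>carrier := carrier (hyperoctahedral m)\<rparr> = hyperoctahedral m"
proof -
  note r = wreath_sym_restrict[OF sym_group_is_group[of 2] assms, folded hyperoctahedral_def]
  show eq: "(hyperoctahedral n)\<lparr>carrier := carrier (hyperoctahedral m)\<rparr> = hyperoctahedral m"
    by (fact r(1))
  show "subgroup (carrier (hyperoctahedral m)) (hyperoctahedral n)"
    using group.group_incl_imp_subgroup[OF group_hyperoctahedral r(2)] eq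
    by (simp add: group_hyperoctahedral)
qed


section \<open>Complex representations\<close>

definition general_linear :: "(complex \<Rightarrow> 'v::ab_group_add \<Rightarrow> 'v) \<Rightarrow> ('v \<Rightarrow> 'v) monoid" where
  "general_linear scale =
     \<lparr> carrier = {f. Vector_Spaces.linear scale scale f \<and> bij f}, mult = (\<circ>), one = id \<rparr>"

text \<open>
  The representation space is the whole type \<open>'v\<close> with the scalar multiplication \<open>scale\<close>. Only the
  values of \<open>\<rho>\<close> on \<open>carrier G\<close> matter, so the restriction of a representation to a subgroup is given
  by the same \<open>\<rho>\<close>.
\<close>

definition complex_representation ::
    "('g, 'b) monoid_scheme \<Rightarrow> (complex \<Rightarrow> 'v::ab_group_add \<Rightarrow> 'v) \<Rightarrow> ('g \<Rightarrow> 'v \<Rightarrow> 'v) \<Rightarrow> bool" where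
  "complex_representation G scale \<rho> \<longleftrightarrow>
     group G \<and> vector_space scale \<and> \<rho> \<in> hom G (general_linear scale)"

definition subrepresentation ::
    "('g, 'b) monoid_scheme \<Rightarrow> (complex \<Rightarrow> 'v::ab_group_add \<Rightarrow> 'v) \<Rightarrow> ('g \<Rightarrow> 'v \<Rightarrow> 'v) \<Rightarrow> 'v set \<Rightarrow> bool" where
  "subrepresentation G scale \<rho> W \<longleftrightarrow>
     module.subspace scale W \<and> (\<forall>g\<in>carrier G. \<rho> g ` W \<subseteq> W)"

definition irreducible_subrepresentation ::
    "('g, 'b) monoid_scheme \<Rightarrow> (complex \<Rightarrow> 'v::ab_group_add \<Rightarrow> 'v) \<Rightarrow> ('g \<Rightarrow> 'v \<Rightarrow> 'v) \<Rightarrow> 'v set \<Rightarrow> bool" where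
  "irreducible_subrepresentation G scale \<rho> W \<longleftrightarrow>
     subrepresentation G scale \<rho> W \<and> W \<noteq> {0} \<and>
     (\<forall>U. subrepresentation G scale \<rho> U \<and> U \<subseteq> W \<longrightarrow> U = {0} \<or> U = W)"

definition irreducible_representation ::
    "('g, 'b) monoid_scheme \<Rightarrow> (complex \<Rightarrow> 'v::ab_group_add \<Rightarrow> 'v) \<Rightarrow> ('g \<Rightarrow> 'v \<Rightarrow> 'v) \<Rightarrow> bool" where
  "irreducible_representation G scale \<rho> \<longleftrightarrow>
     complex_representation G scale \<rho> \<and> irreducible_subrepresentation G scale \<rho> UNIV"

text \<open>
  \<^const>\<open>vector_space.dim\<close> is \<open>0\<close> on infinite-dimensional spaces, so odd dimension includes finite
  dimension.
\<close>

definition odd_dimensional :: "(complex \<Rightarrow> 'v::ab_group_add \<Rightarrow> 'v) \<Rightarrow> 'v set \<Rightarrow> bool" where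
  "odd_dimensional scale W \<longleftrightarrow> odd (vector_space.dim scale W)"

lemma complex_representation_restrict_hyperoctahedral:
  assumes "complex_representation (hyperoctahedral n) scale \<rho>" and "m \<le> n"
  shows "complex_representation (hyperoctahedral m) scale \<rho>"
proof -
  have "carrier (hyperoctahedral m) \<subseteq> carrier (hyperoctahedral n)"
    using subgroup_hyperoctahedral(1)[OF assms(2)] by (rule subgroup.subset)
  moreover have "mult (hyperoctahedral m) = mult (hyperoctahedral n)"
    by (simp add: hyperoctahedral_def wreath_sym_def sym_group_def)
  ultimately show ?thesis
    using assms(1) group_hyperoctahedral[of m]
    by (auto simp: complex_representation_def hom_def)
qed

end

theory Submission
  imports Defs "HOL-Computational_Algebra.Fundamental_Theorem_Algebra"
begin

text \<open>
  With respect to an invariant Hermitian form the Jucys--Murphy operators and the sign changes are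
  commuting self-adjoint operators. As in the approach of Okounkov and Vershik, the restriction of an
  irreducible representation to the next smaller group is the direct sum of the eigenspaces of the last
  pair of them; these are irreducible, and the sequences of eigenvalues occurring are exactly the paths
  in the lattice of bipartitions that end in a fixed bipartition. So dimensions are path numbers.

  Modulo 2, taking \<open>2 ^ k\<close> steps down in this lattice amounts to removing one rim hook of length
  \<open>2 ^ k\<close>. If \<open>2 ^ k \<le> n < 2 ^ Suc k\<close>, then at most one such hook exists, and removing it maps the odd
  neighbours of a bipartition injectively to the odd neighbours of a smaller one. By induction there is
  exactly one odd neighbour; hooks themselves (\<open>n = 2 ^ k\<close>) have at most two neighbours.
\<close>

section \<open>Maya diagrams\<close>

text \<open>The collapse of \<open>2 ^ k\<close> steps comes from squaring: if
  \<open>slide_sum s\<close> sums over all slides by \<open>s\<close>, then two independent slides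
  occur in both orders and cancel modulo 2, so its square is congruent to
  \<open>slide_sum (2 * s)\<close>. Keeping both components on one line lets a single sum over beads
  serve both, since all steps that arise from 2 by doubling preserve parity. Each slide by
  \<open>s\<close> costs \<open>s\<close> units of \<open>energy\<close>, and a bipartition has
  twice as many units as boxes; this is why the largest power of 2 leaves room for one hook only.
  The uniqueness to be shown concerns subspaces, not isomorphism classes. An irreducible subspace
  could a priori lie diagonally across several eigenspaces. This is excluded because the eigenvalue
  sequences of an irreducible subspace determine its diagram, and the last eigenvalue in the big
  group determines the box that was removed. Hence the induction over the tower carries the whole
  set of paths and not the dimension alone.\<close>

text \<open>
  A bipartition is stored as one set of bead positions (a Maya diagram), the even and the odd positions
  carrying its two components; removing a box is a slide by 2. So \<open>path_count n Y\<close> counts the standard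
  bitableaux of size \<open>n\<close> and shape \<open>Y\<close>.
\<close>

definition vacuum :: "int set" where "vacuum = {..<0}"

definition movable :: "int \<Rightarrow> int set \<Rightarrow> int set" where
  "movable s Y = {p \<in> Y. p - s \<notin> Y}"

definition slide :: "int \<Rightarrow> int \<Rightarrow> int set \<Rightarrow> int set" where
  "slide s p Y = insert (p - s) (Y - {p})"

definition slide_sum :: "int \<Rightarrow> (int set \<Rightarrow> nat) \<Rightarrow> int set \<Rightarrow> nat" where
  "slide_sum s g Y = (\<Sum>p\<in>movable s Y. g (slide s p Y))"

primrec path_count :: "nat \<Rightarrow> int set \<Rightarrow> nat" where
  "path_count 0 Y = of_bool (Y = vacuum)"
| "path_count (Suc n) Y = slide_sum 2 (path_count n) Y"

text \<open>The charge of the two components is left open: slides by 2 preserve it, so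
  \<open>path_count\<close> is 0 on every diagram that is not a bipartition.\<close>

definition maya :: "int set \<Rightarrow> bool" where
  "maya Y \<longleftrightarrow> finite (sym_diff Y vacuum)"

text \<open>For a bipartition this is twice the number of boxes, as each box is worth one slide by
  2.\<close>

definition energy :: "int set \<Rightarrow> int" where
  "energy Y = (\<Sum>x\<in>sym_diff Y vacuum. \<bar>x\<bar>)"

lemma maya_slide:
  assumes "p \<in> Y"
  shows "maya (slide s p Y) \<longleftrightarrow> maya Y"
proof -
  have "sym_diff (slide s p Y) vacuum \<subseteq> sym_diff Y vacuum \<union> {p, p - s}"
    and "sym_diff Y vacuum \<subseteq> sym_diff (slide s p Y) vacuum \<union> {p, p - s}"
    by (auto simp: slide_def)
  then show ?thesis
    unfolding maya_def by (meson finite.emptyI finite_Un finite_insert finite_subset)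
qed

lemma maya_slide_movable: "maya Y \<Longrightarrow> p \<in> movable s Y \<Longrightarrow> maya (slide r p Y)"
  by (simp add: maya_slide movable_def)

text \<open>A bead at \<open>x \<ge> 0\<close> counts \<open>x\<close>, a hole at
  \<open>x < 0\<close> counts \<open>- x\<close>. Written with signs over any large enough
  \<open>F\<close>, the energies of two diagrams can be subtracted term by term.\<close>

lemma energy_eq:
  assumes "finite F" "sym_diff Y vacuum \<subseteq> F"
  shows "energy Y = (\<Sum>x\<in>F. x * (of_bool (x \<in> Y) - of_bool (x \<in> vacuum)))"
proof -
  have "(\<Sum>x\<in>F. x * (of_bool (x \<in> Y) - of_bool (x \<in> vacuum))) =
      (\<Sum>x\<in>sym_diff Y vacuum. x * (of_bool (x \<in> Y) - of_bool (x \<in> vacuum)))"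
    by (rule sum.mono_neutral_right) (use assms in auto)
  also have "\<dots> = energy Y"
    unfolding energy_def by (rule sum.cong) (auto simp: vacuum_def)
  finally show ?thesis by simp
qed

lemma energy_nonneg: "0 \<le> energy Y"
  unfolding energy_def by (simp add: sum_nonneg)

lemma energy_slide:
  assumes "maya Y" "p \<in> movable s Y"
  shows "energy (slide s p Y) = energy Y - s"
proof -
  define F where "F = sym_diff Y vacuum \<union> {p, p - s}"
  define h where "h = (\<lambda>x. of_bool (x \<in> vacuum) :: int)"
  have F: "finite F" "sym_diff Y vacuum \<subseteq> F" "sym_diff (slide s p Y) vacuum \<subseteq> F"
    using assms by (auto simp: F_def maya_def slide_def)
  have p: "p \<in> Y" "p - s \<notin> Y" and "s \<noteq> 0" using assms by (auto simp: movable_def)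
  have "energy (slide s p Y) - energy Y =
     (\<Sum>x\<in>F. x * (of_bool (x \<in> slide s p Y) - of_bool (x \<in> Y)))"
    using energy_eq[OF F(1,2)] energy_eq[OF F(1,3)]
    by (simp add: sum_subtractf[symmetric] right_diff_distrib)
  also have "\<dots> = (\<Sum>x\<in>{p, p - s}. x * (of_bool (x \<in> slide s p Y) - of_bool (x \<in> Y)))"
    by (rule sum.mono_neutral_right) (use F in \<open>auto simp: F_def slide_def\<close>)
  also have "\<dots> = - s" using p \<open>s \<noteq> 0\<close> by (simp add: slide_def)
  finally show ?thesis by simp
qed

text \<open>A bead that can move either deviates from \<open>vacuum\<close> itself or moves into a
  hole that does. The interval \<open>{s..<0}\<close> catches negative \<open>s\<close>, where a
  bead can jump from the filled half to the empty one.\<close>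

lemma finite_movable:
  assumes "maya Y"
  shows "finite (movable s Y)"
proof -
  have "movable s Y \<subseteq> sym_diff Y vacuum \<union> (+) s ` sym_diff Y vacuum \<union> {s..<0}"
  proof
    fix p assume p: "p \<in> movable s Y"
    have "p \<in> (+) s ` sym_diff Y vacuum" if "p - s < 0"
      by (rule image_eqI[of _ _ "p - s"]) (use that p in \<open>auto simp: movable_def vacuum_def\<close>)
    moreover have "p \<in> sym_diff Y vacuum" if "0 \<le> p"
      using that p by (auto simp: movable_def vacuum_def)
    ultimately show "p \<in> sym_diff Y vacuum \<union> (+) s ` sym_diff Y vacuum \<union> {s..<0}"
      by (cases "p < 0"; cases "p - s < 0") (auto simp: p)
  qed
  then show ?thesis using assms unfolding maya_def by (meson finite_UnI finite_atLeastLessThan_int finite_imageI finite_subset)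
qed

lemma path_count_nonzero:
  "path_count n Y \<noteq> 0 \<Longrightarrow> maya Y \<and> energy Y = 2 * int n"
proof (induction n arbitrary: Y)
  case 0
  then show ?case by (auto simp: maya_def energy_def split: if_splits)
next
  case (Suc n)
  then have "\<exists>p\<in>movable 2 Y. path_count n (slide 2 p Y) \<noteq> 0"
    unfolding path_count.simps slide_sum_def by (meson sum.neutral)
  then obtain p where p: "p \<in> movable 2 Y" "path_count n (slide 2 p Y) \<noteq> 0" by blast
  with Suc.IH have "maya (slide 2 p Y)" "energy (slide 2 p Y) = 2 * int n" by auto
  with p maya_slide[of p Y 2] energy_slide[of Y p 2] show ?case
    by (auto simp: movable_def)
qed

section \<open>Slide sums modulo 2\<close>

lemma even_sum_swap:
  fixes h :: "'a \<times> 'a \<Rightarrow> nat"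
  assumes "finite A" "\<And>x y. (x, y) \<in> A \<Longrightarrow> (y, x) \<in> A \<and> x \<noteq> y \<and> h (y, x) = h (x, y)"
  shows "even (sum h A)"
  using assms
proof (induction "card A" arbitrary: A rule: less_induct)
  case less
  show ?case
  proof (cases "A = {}")
    case False
    then obtain x y where xy: "(x, y) \<in> A" by auto
    then have yx: "(y, x) \<in> A" "x \<noteq> y" "h (y, x) = h (x, y)" using less.prems by auto
    define B where "B = A - {(x, y), (y, x)}"
    have "card B < card A" unfolding B_def using xy less.prems(1)
      by (intro psubset_card_mono) auto
    have "finite B" using less.prems(1) by (simp add: B_def)
    have "\<And>u v. (u, v) \<in> B \<Longrightarrow> (v, u) \<in> B \<and> u \<noteq> v \<and> h (v, u) = h (u, v)"
      using less.prems(2) by (auto simp: B_def)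
    then have "even (sum h B)" by (rule less.hyps[OF \<open>card B < card A\<close> \<open>finite B\<close>])
    moreover have "sum h A = sum h B + sum h {(x, y), (y, x)}"
      unfolding B_def using xy yx less.prems(1) by (intro sum.subset_diff) auto
    ultimately show ?thesis using yx by simp
  qed simp
qed

text \<open>
  Two slides of different beads in either order cancel modulo 2, unless one bead follows the other;
  what remains are the slides by the double distance.
\<close>

lemma slide_sum_twice:
  assumes "maya Y" "0 < s"
  shows "even (slide_sum s (slide_sum s g) Y + slide_sum (2 * s) g Y)"
proof -
  define P where "P = Sigma (movable s Y) (\<lambda>p. movable s (slide s p Y))"
  define h where "h = (\<lambda>(p, q). g (slide s q (slide s p Y)))"
  define P1 where "P1 = {(p, q) \<in> P. q = p - s}"
  define P2 where "P2 = {(p, q) \<in> P. q = p + s}"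
  define P3 where "P3 = {(p, q) \<in> P. q \<noteq> p - s \<and> q \<noteq> p + s}"
  have fin: "finite P"
    unfolding P_def using assms by (intro finite_SigmaI finite_movable maya_slide_movable)
  have f123: "finite P1" "finite P2" "finite P3"
    using fin by (auto simp: P1_def P2_def P3_def intro: finite_subset[OF _ fin])
  have "slide_sum s (slide_sum s g) Y = sum h P"
    unfolding slide_sum_def P_def h_def using assms
    by (subst sum.Sigma) (auto intro: finite_movable maya_slide_movable)
  also have "P = P1 \<union> (P2 \<union> P3)" using assms(2) by (auto simp: P1_def P2_def P3_def)
  also have "sum h (P1 \<union> (P2 \<union> P3)) = sum h P1 + (sum h P2 + sum h P3)"
    using f123 assms(2)
    by (subst sum.union_disjoint, simp, simp, force simp: P1_def P2_def P3_def)+ simp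
  finally have 1: "slide_sum s (slide_sum s g) Y = sum h P1 + (sum h P2 + sum h P3)" .
  have 3: "even (sum h P3)"
  proof (rule even_sum_swap[OF f123(3)])
    fix p q assume "(p, q) \<in> P3"
    then have "p \<in> Y" "p - s \<notin> Y" "q \<in> Y" "q - s \<notin> Y" "p \<noteq> q" "q \<noteq> p - s" "q \<noteq> p + s"
      by (auto simp: P3_def P_def movable_def slide_def)
    then show "(q, p) \<in> P3 \<and> p \<noteq> q \<and> h (q, p) = h (p, q)"
      using assms(2) by (auto simp: P3_def P_def movable_def slide_def h_def insert_commute
         intro!: arg_cong[where f = g])
  qed
  \<comment> \<open>Each slide of a bead by \<open>2 * s\<close> arises exactly once: in
    \<open>P1\<close> if the place halfway is empty, so that the bead itself makes both moves, and
    in \<open>P2\<close> if it is occupied, so that the bead there moves on and the outer one takes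
    its place.\<close>
  define Q where "Q = movable (2 * s) Y"
  have "sum h P1 = (\<Sum>p\<in>{p \<in> Q. p - s \<notin> Y}. g (slide (2 * s) p Y))"
    by (rule sum.reindex_bij_witness[where i = "\<lambda>p. (p, p - s)" and j = fst])
      (use assms(2) in \<open>auto simp: P1_def P_def Q_def movable_def slide_def h_def
         intro!: arg_cong[where f = g]\<close>)
  moreover have "sum h P2 = (\<Sum>p\<in>{p \<in> Q. p - s \<in> Y}. g (slide (2 * s) p Y))"
  proof (rule sum.reindex_bij_witness[where i = "\<lambda>p. (p - s, p)" and j = snd])
    fix x assume "x \<in> P2"
    then obtain p where x: "x = (p, p + s)" "p \<in> Y" "p - s \<notin> Y" "p + s \<in> Y"
      by (auto simp: P2_def P_def movable_def slide_def)
    have [simp]: "p + s - 2 * s = p - s" by simp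
    have "slide s (p + s) (slide s p Y) = slide (2 * s) (p + s) Y"
      using x assms(2) by (auto simp: slide_def)
    then show "(snd x - s, snd x) = x" "snd x \<in> {p \<in> Q. p - s \<in> Y}" "g (slide (2 * s) (snd x) Y) = h x"
      using x by (auto simp: Q_def movable_def h_def)
  next
    fix p assume "p \<in> {p \<in> Q. p - s \<in> Y}"
    then show "(p - s, p) \<in> P2" "snd (p - s, p) = p"
      using assms(2) by (auto simp: P2_def P_def Q_def movable_def slide_def)
  qed
  moreover have "slide_sum (2 * s) g Y = (\<Sum>p\<in>{p \<in> Q. p - s \<notin> Y}. g (slide (2 * s) p Y)) +
     (\<Sum>p\<in>{p \<in> Q. p - s \<in> Y}. g (slide (2 * s) p Y))"
    unfolding slide_sum_def using finite_movable[OF assms(1), of "2 * s"]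
    by (subst sum.union_disjoint[symmetric]) (auto intro!: sum.cong simp: Q_def)
  ultimately show ?thesis using 1 3 by simp
qed

lemma slide_sum_cong_mod2:
  assumes "maya Y" "\<And>Y. maya Y \<Longrightarrow> even (g Y + h Y)"
  shows "even (slide_sum s g Y + slide_sum s h Y)"
  unfolding slide_sum_def sum.distrib[symmetric]
  by (rule dvd_sum) (use assms in \<open>auto simp: movable_def maya_slide\<close>)

text \<open>Repeated squaring, starting from step 2. Within one component, whose positions are 2
  apart, a slide by \<open>2 * 2 ^ k\<close> removes a rim hook of length
  \<open>2 ^ k\<close>.\<close>

lemma slide_sum_power:
  assumes "maya Y"
  shows "even ((slide_sum 2 ^^ (2 ^ k)) g Y + slide_sum (2 * 2 ^ k) g Y)"
  using assms
proof (induction k arbitrary: g Y)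
  case (Suc k)
  let ?D = "slide_sum 2 ^^ (2 ^ k)"
  have "(2::nat) ^ Suc k = 2 ^ k + 2 ^ k" by simp
  then have e: "(slide_sum 2 ^^ (2 ^ Suc k)) g Y = ?D (?D g) Y"
    by (simp only: funpow_add comp_apply)
  have "even (?D (?D g) Y + slide_sum (2 * 2 ^ k) (?D g) Y)" using Suc by blast
  moreover have "even (slide_sum (2 * 2 ^ k) (?D g) Y + slide_sum (2 * 2 ^ k) (slide_sum (2 * 2 ^ k) g) Y)"
    using Suc by (intro slide_sum_cong_mod2) auto
  moreover have "even (slide_sum (2 * 2 ^ k) (slide_sum (2 * 2 ^ k) g) Y + slide_sum (2 * 2 ^ Suc k) g Y)"
    using slide_sum_twice[of Y "2 * 2 ^ k" g] Suc by (simp add: mult.assoc)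
  ultimately show ?case unfolding e by simp
qed simp

lemma path_count_add: "path_count (j + m) = (slide_sum 2 ^^ j) (path_count m)"
proof (induction j)
  case (Suc j)
  have "path_count (Suc j + m) = slide_sum 2 (path_count (j + m))" by (rule ext) simp
  with Suc show ?case by simp
qed simp

section \<open>The hook whose length is the largest power of 2\<close>

lemma slide_twice_energy:
  assumes "maya Y" "energy Y < 2 * s" "p \<in> movable s Y"
  shows "movable s (slide s p Y) = {}"
proof (rule ccontr)
  assume "movable s (slide s p Y) \<noteq> {}"
  then obtain q where "q \<in> movable s (slide s p Y)" by blast
  moreover have "maya (slide s p Y)" using assms by (simp add: maya_slide movable_def)
  ultimately show False
    using energy_slide[of "slide s p Y" q s] energy_slide[of Y p s]
      energy_nonneg[of "slide s q (slide s p Y)"] assms by simp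
qed

text \<open>Oddness passes to \<open>slide_sum s\<close>, so some bead \<open>z\<close> moves by
  \<open>s\<close>. A second such bead would still be movable after \<open>z\<close> has moved, but
  two slides by \<open>s\<close> cost more than the available energy
  \<open>2 * (2 ^ k + m) < 2 * s\<close>.\<close>

lemma odd_path_count_big_slide:
  assumes "odd (path_count (2 ^ k + m) Y)" "m < 2 ^ k"
  defines "s \<equiv> 2 * 2 ^ k"
  obtains z where "movable s Y = {z}" "odd (path_count m (slide s z Y))"
    "movable s (slide s z Y) = {}"
proof -
  have "path_count (2 ^ k + m) Y \<noteq> 0" using assms(1) by (metis even_zero)
  then have Y: "maya Y" "energy Y = 2 * int (2 ^ k + m)" using path_count_nonzero by blast+
  have "int m < 2 ^ k" using assms(2) by (metis of_nat_less_iff of_nat_numeral of_nat_power)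
  then have "energy Y < 2 * s" using Y by (simp add: s_def)
  note empty = slide_twice_energy[OF Y(1) this]
  have "odd (slide_sum s (path_count m) Y)"
    using slide_sum_power[OF Y(1), of k "path_count m"] assms(1) by (simp add: path_count_add s_def)
  then obtain z where z: "z \<in> movable s Y"
    unfolding slide_sum_def by (metis dvd_0_right equals0I sum.empty)
  have "q = z" if "q \<in> movable s Y" for q
    using empty[OF z] that z by (auto simp: movable_def slide_def)
  then have "movable s Y = {z}" using z by blast
  then show thesis using that empty[OF z] \<open>odd (slide_sum s (path_count m) Y)\<close>
    by (simp add: slide_sum_def)
qed

text \<open>Removing a box and then the big hook is the same as removing the big hook and then a
  box; only the bead that performs the box move is renamed to \<open>c\<close>. If it is
  \<open>z\<close> itself, it makes this move from its new place \<open>z - s\<close>. If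
  \<open>p - 2 = z - s\<close>, then \<open>p\<close> blocks the landing place of \<open>z\<close>,
  and \<open>p + s = z + 2\<close> jumps into the place left by \<open>p\<close>; in the other order
  \<open>z\<close> lands on \<open>p - 2\<close> and \<open>z + 2\<close> slides to
  \<open>z\<close>. Otherwise the two moves do not meet.\<close>

lemma slide_commute:
  assumes "4 \<le> s" "movable s Y = {z}" "movable s (slide s z Y) = {}"
    and "p \<in> movable 2 Y" "movable s (slide 2 p Y) = {y}"
  defines "c \<equiv> if p = z then p - s else if p = z + 2 - s then z + 2 else p"
  shows "c \<in> movable 2 (slide s z Y)" "slide s y (slide 2 p Y) = slide 2 c (slide s z Y)"
proof -
  have mem: "q \<in> movable r X \<longleftrightarrow> q \<in> X \<and> q - r \<notin> X" for q r X by (simp add: movable_def)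
  have z: "z \<in> Y" "z - s \<notin> Y" and zu: "\<And>q. q \<in> Y \<Longrightarrow> q - s \<notin> Y \<Longrightarrow> q = z"
    using assms(2) mem[of _ s Y] by blast+
  have p: "p \<in> Y" "p - 2 \<notin> Y" using assms(4) mem by blast+
  have y: "y \<in> slide 2 p Y" "y - s \<notin> slide 2 p Y"
    and yu: "\<And>q. q \<in> slide 2 p Y \<Longrightarrow> q - s \<notin> slide 2 p Y \<Longrightarrow> q = y"
    using assms(5) mem[of _ s "slide 2 p Y"] by blast+
  have e: "\<And>q. q \<in> slide s z Y \<Longrightarrow> q - s \<in> slide s z Y"
    using assms(3) mem[of _ s "slide s z Y"] by blast
  consider (a) "y \<noteq> p - 2" "y - s \<notin> Y" | (b) "y = p + s" | (c) "y = p - 2" "p - s \<notin> Y"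
    | (d) "y = p - 2" "p - s \<in> Y"
    using y by (auto simp: slide_def)
  then have "c \<in> movable 2 (slide s z Y) \<and> slide s y (slide 2 p Y) = slide 2 c (slide s z Y)"
  proof cases
    case a
    then have "y = z" "p \<noteq> z" using y zu[of y] by (auto simp: slide_def)
    moreover have "z - s \<noteq> p - 2" using y(2) \<open>y = z\<close> by (auto simp: slide_def)
    moreover from this have "c = p" using \<open>p \<noteq> z\<close> by (auto simp: c_def)
    moreover have "insert (z - s) (insert (p - 2) (Y - {p}) - {z}) =
        insert (p - 2) (insert (z - s) (Y - {z}) - {p})"
      using p z \<open>p \<noteq> z\<close> by blast
    ultimately show ?thesis using p z by (simp add: movable_def slide_def)
  next
    case b
    have pz: "p \<noteq> z"
    proof
      assume "p = z"
      then have "p + s \<in> slide s z Y" "p + s - s \<notin> slide s z Y"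
        using y b assms(1) by (auto simp: slide_def)
      then show False using e by blast
    qed
    have zp: "z - s = p - 2"
    proof (rule ccontr)
      assume "z - s \<noteq> p - 2"
      then have "z = y" using yu[of z] z pz by (auto simp: slide_def)
      then show False using b z p by simp
    qed
    have c: "c = p + s" using zp pz by (simp add: c_def)
    have eqs: "p + s - 2 = z" "p + s - s = p" using zp b c by auto
    have "p + s \<in> Y" using y(1) b assms(1) by (auto simp: slide_def)
    moreover have "p + s \<noteq> z" using zp by simp
    moreover have "p \<noteq> p + s" "p - 2 \<noteq> p + s" "z \<noteq> p - 2" using assms(1) zp by auto
    ultimately have "insert p (insert (p - 2) (Y - {p}) - {p + s}) =
        insert z (insert (p - 2) (Y - {z}) - {p + s})" "p + s \<in> insert (p - 2) (Y - {z})"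
        "z \<notin> insert (p - 2) (Y - {z})"
      using p z pz by auto
    moreover have "slide s y (slide 2 p Y) = insert p (insert (p - 2) (Y - {p}) - {p + s})"
      unfolding slide_def eqs b ..
    moreover have "slide 2 c (slide s z Y) = insert z (insert (p - 2) (Y - {z}) - {p + s})"
      unfolding slide_def zp c eqs ..
    moreover have "c \<in> movable 2 (slide s z Y) \<longleftrightarrow> p + s \<in> insert (p - 2) (Y - {z}) \<and> z \<notin> insert (p - 2) (Y - {z})"
      unfolding movable_def slide_def zp c mem_Collect_eq eqs(1) ..
    ultimately show ?thesis by simp
  next
    case c
    then have "p = z" using zu p by blast
    have cc: "c = p - s" using \<open>p = z\<close> by (simp add: c_def)
    have swap: "x - 2 - s = x - s - 2" for x by simp
    have ne: "p - 2 - s \<noteq> p" "p - 2 - s \<notin> Y" using y(2) c assms(1) by (auto simp: slide_def)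
    have "insert (p - 2 - s) (insert (p - 2) (Y - {p}) - {p - 2}) =
        insert (p - 2 - s) (insert (p - s) (Y - {p}) - {p - s})"
      using p c by blast
    moreover have "p - 2 - s \<noteq> p - s" by simp
    ultimately show ?thesis using ne cc c \<open>p = z\<close>
      by (simp add: movable_def slide_def swap)
  next
    \<comment> \<open>Here \<open>z\<close> has to be blocked by the bead at \<open>p - 2\<close>.
      But once \<open>z\<close> itself has moved to that place, it could move by \<open>s\<close>
      again, against \<open>assms(3)\<close>.\<close>
    case d
    then have "p \<noteq> z" using z by auto
    have zp: "z - s = p - 2"
    proof (rule ccontr)
      assume "z - s \<noteq> p - 2"
      then have "z = y" using yu[of z] z \<open>p \<noteq> z\<close> by (auto simp: slide_def)
      then show False using d z p by simp
    qed
    then have "p - 2 - s \<in> slide s z Y" using e[of "p - 2"] by (simp add: slide_def)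
    moreover have "p - 2 - s \<notin> Y" using y(2) d(1) assms(1) by (auto simp: slide_def)
    ultimately have False using zp assms(1) by (simp add: slide_def)
    then show ?thesis ..
  qed
  then show "c \<in> movable 2 (slide s z Y)" "slide s y (slide 2 p Y) = slide 2 c (slide s z Y)"
    by auto
qed

theorem unique_odd_slide:
  assumes "odd (path_count (Suc n) Y)"
  shows "\<exists>!p. p \<in> movable 2 Y \<and> odd (path_count n (slide 2 p Y))"
  using assms
proof (induction n arbitrary: Y rule: less_induct)
  case (less n)
  have ex: "\<exists>p. p \<in> movable 2 Y \<and> odd (path_count n (slide 2 p Y))"
  proof (rule ccontr)
    assume "\<not> ?thesis"
    then have "even (slide_sum 2 (path_count n) Y)"
      unfolding slide_sum_def by (intro dvd_sum) auto
    with less.prems show False by simp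
  qed
  obtain k where k: "2 ^ k \<le> Suc n" "Suc n < 2 ^ (Suc k)"
    using ex_power_ivl1[of 2 "Suc n"] by auto
  define m where "m = Suc n - 2 ^ k"
  have n: "Suc n = 2 ^ k + m" "m < 2 ^ k" using k by (auto simp: m_def)
  define s :: int where "s = 2 * 2 ^ k"
  obtain z where z: "movable s Y = {z}" "odd (path_count m (slide s z Y))"
      "movable s (slide s z Y) = {}"
    using odd_path_count_big_slide[of k m Y] less.prems n by (metis s_def)
  have uniq: "p = q" if p: "p \<in> movable 2 Y" "odd (path_count n (slide 2 p Y))"
    and q: "q \<in> movable 2 Y" "odd (path_count n (slide 2 q Y))" for p q
  proof (cases m)
    \<comment> \<open>\<open>Y\<close> is a single hook: \<open>vacuum\<close> with one bead lifted
      from \<open>z - s\<close> to \<open>z\<close>. Only the lifted bead and the bead right above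
      the gap can move by 2, and two odd summands would make the total even.\<close>
    case 0
    then have vac: "slide s z Y = vacuum" using z(2) by (auto split: if_splits)
    have zY: "z \<in> Y" "z - s \<notin> Y" using z(1) by (auto simp: movable_def)
    have Y: "x \<in> Y \<longleftrightarrow> x = z \<or> x < 0 \<and> x \<noteq> z - s" for x
    proof -
      have "x \<in> vacuum \<longleftrightarrow> x = z - s \<or> x \<in> Y \<and> x \<noteq> z"
        unfolding vac[symmetric] by (auto simp: slide_def)
      then show ?thesis using zY by (auto simp: vacuum_def)
    qed
    have two: "x = z \<or> x = z - s + 2" if "x \<in> movable 2 Y" for x
      using that by (auto simp: movable_def Y)
    show ?thesis
    proof (rule ccontr)
      assume "p \<noteq> q"
      then have "movable 2 Y = {p, q}" using two p q by (smt (verit) Collect_cong insertCI insertE insert_absorb subsetI subset_antisym singletonD)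
      then have "even (slide_sum 2 (path_count n) Y)" using p q \<open>p \<noteq> q\<close> by (simp add: slide_sum_def)
      with less.prems show False by simp
    qed
  next
    case (Suc l)
    \<comment> \<open>A nonzero remainder below \<open>2 ^ k\<close> forces \<open>k > 0\<close>,
      which yields the bound \<open>4 \<le> s\<close> of \<open>slide_commute\<close>.\<close>
    have "k \<noteq> 0" using n(2) Suc by (metis not_less_eq power_0 Zero_not_Suc less_one)
    then have "(2::int) ^ 1 \<le> 2 ^ k" by (intro power_increasing) auto
    then have s4: "4 \<le> s" by (simp add: s_def)
    have n': "n = 2 ^ k + l" "l < 2 ^ k" "l < n" using n Suc by auto
    define c where "c = (\<lambda>p. if p = z then p - s else if p = z + 2 - s then z + 2 else p)"
    have c: "c x \<in> movable 2 (slide s z Y) \<and> odd (path_count l (slide 2 (c x) (slide s z Y)))"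
      if x: "x \<in> movable 2 Y" "odd (path_count n (slide 2 x Y))" for x
    proof -
      obtain y where y: "movable s (slide 2 x Y) = {y}" "odd (path_count l (slide s y (slide 2 x Y)))"
        using odd_path_count_big_slide[of k l "slide 2 x Y"] x n' by (metis s_def)
      show ?thesis
        using slide_commute[OF s4 z(1,3) x(1) y(1)] y(2) by (simp add: c_def)
    qed
    have "odd (path_count (Suc l) (slide s z Y))" using z Suc by simp
    then have "c p = c q" using less.IH[OF \<open>l < n\<close>] c[OF p] c[OF q] by blast
    moreover have "z - s \<notin> Y" "z \<in> Y" using z(1) by (auto simp: movable_def)
    \<comment> \<open>\<open>c\<close> is injective on the movable beads: the new value
      \<open>z - s\<close> is no bead of \<open>Y\<close>, and a bead at \<open>z + 2\<close> cannot
      move by 2 while \<open>z\<close> is occupied.\<close>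
    ultimately show ?thesis using p(1) q(1) s4 by (auto simp: c_def movable_def split: if_splits)
  qed
  show ?case using ex uniq by blast
qed

section \<open>Normal operators\<close>

text \<open>\<open>ip\<close> is conjugate-linear in its second argument. Definiteness enters as
  anisotropy: vectors are shown to vanish by being orthogonal to themselves.\<close>

locale hermitian_space = finite_dimensional_vector_space scale Basis
  for scale :: "complex \<Rightarrow> 'v::ab_group_add \<Rightarrow> 'v" (infixr \<open>*s\<close> 75) and Basis +
  fixes ip :: "'v \<Rightarrow> 'v \<Rightarrow> complex"
  assumes ip_add_left: "ip (u + v) w = ip u w + ip v w"
    and ip_scale_left: "ip (c *s u) v = c * ip u v"
    and ip_commute: "ip v u = cnj (ip u v)"
    and ip_anisotropic: "ip u u = 0 \<Longrightarrow> u = 0"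
begin

abbreviation lin :: "('v \<Rightarrow> 'v) \<Rightarrow> bool" where "lin \<equiv> Vector_Spaces.linear scale scale"

lemma lin_iff: "lin T \<longleftrightarrow> (\<forall>u v. T (u + v) = T u + T v) \<and> (\<forall>c u. T (c *s u) = c *s T u)"
  using vector_space_axioms by (simp add: Vector_Spaces.linear_iff)

lemma lin_simps:
  assumes "lin T"
  shows "T (u + v) = T u + T v" "T (c *s u) = c *s T u" "T 0 = 0" "T (u - v) = T u - T v"
    "T (- u) = - T u" "T (\<Sum>i\<in>A. f i) = (\<Sum>i\<in>A. T (f i))"
proof -
  interpret T: Vector_Spaces.linear scale scale T by fact
  show "T (u + v) = T u + T v" "T (c *s u) = c *s T u" "T 0 = 0" "T (u - v) = T u - T v"
    "T (- u) = - T u" "T (\<Sum>i\<in>A. f i) = (\<Sum>i\<in>A. T (f i))"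
    by (simp_all add: T.add T.scale T.zero T.diff T.neg T.sum)
qed

lemma ip_zero_left [simp]: "ip 0 v = 0"
  using ip_scale_left[of 0 0 v] by simp

lemma ip_zero_right [simp]: "ip v 0 = 0"
  using ip_commute[of v 0] by simp

lemma ip_add_right: "ip w (u + v) = ip w u + ip w v"
  using ip_add_left[of u v w] ip_commute by (metis complex_cnj_add)

lemma ip_scale_right: "ip u (c *s v) = cnj c * ip u v"
  using ip_scale_left[of c v u] ip_commute by (metis complex_cnj_mult)

lemma ip_minus_left: "ip (- u) w = - ip u w"
  using ip_scale_left[of "-1" u w] by simp

lemma ip_diff_left: "ip (u - v) w = ip u w - ip v w"
  using ip_add_left[of u "- v" w] by (simp add: ip_minus_left)

lemma ip_diff_right: "ip w (u - v) = ip w u - ip w v"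
  using ip_diff_left[of u v w] ip_commute by (metis complex_cnj_diff)

lemma span_invariant:
  assumes "lin T" "\<And>x. x \<in> S \<Longrightarrow> T x \<in> span S'" "x \<in> span S"
  shows "T x \<in> span S'"
  using assms(3)
  by (induction rule: span_induct_alt)
    (auto simp: lin_simps[OF assms(1)] intro: span_add span_scale span_zero assms(2))

definition adjoint_pair :: "('v \<Rightarrow> 'v) \<Rightarrow> ('v \<Rightarrow> 'v) \<Rightarrow> bool" where
  "adjoint_pair N N' \<longleftrightarrow> lin N \<and> lin N' \<and> (\<forall>u v. ip (N u) v = ip u (N' v))"

text \<open>The adjoint is existentially quantified, so none has to be constructed in general; for
  \<open>wop\<close> it can be written down.\<close>

definition normal_op :: "('v \<Rightarrow> 'v) \<Rightarrow> bool" where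
  "normal_op N \<longleftrightarrow> (\<exists>N'. adjoint_pair N N' \<and> (\<forall>u. N (N' u) = N' (N u)))"

lemma adjoint_pair_shift:
  assumes "adjoint_pair N N'"
  shows "adjoint_pair (\<lambda>u. N u - z *s u) (\<lambda>u. N' u - cnj z *s u)"
  using assms by (auto simp: adjoint_pair_def lin_iff ip_diff_left ip_diff_right ip_scale_left
      ip_scale_right algebra_simps scale_left_commute)

lemma normal_op_shift:
  assumes "normal_op N"
  shows "normal_op (\<lambda>u. N u - z *s u)"
proof -
  obtain N' where N': "adjoint_pair N N'" "\<And>u. N (N' u) = N' (N u)"
    using assms by (auto simp: normal_op_def)
  then have "lin N" "lin N'" by (auto simp: adjoint_pair_def)
  then show ?thesis
    unfolding normal_op_def using adjoint_pair_shift[OF N'(1), of z]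
    by (intro exI[of _ "\<lambda>u. N' u - cnj z *s u"])
      (simp add: N'(2) lin_simps[OF \<open>lin N\<close>] lin_simps[OF \<open>lin N'\<close>] algebra_simps scale_left_commute)
qed

lemma normal_op_linear: "normal_op N \<Longrightarrow> lin N"
  by (auto simp: normal_op_def adjoint_pair_def)

lemma adjoint_kernel:
  assumes "adjoint_pair N N'" "\<And>u. N (N' u) = N' (N u)" "N v = 0"
  shows "N' v = 0"
proof -
  have "ip (N' v) (N' v) = ip (N (N' v)) v" using assms(1) by (simp add: adjoint_pair_def)
  also have "\<dots> = 0" using assms by (simp add: adjoint_pair_def lin_simps)
  finally show ?thesis by (rule ip_anisotropic)
qed

text \<open>Excludes Jordan blocks, after a shift for every eigenvalue: \<open>N v\<close> lies in
  the kernel of \<open>N\<close>, hence in that of the adjoint, and so is orthogonal to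
  itself.\<close>

lemma normal_op_kernel_square:
  assumes "normal_op N" "N (N v) = 0"
  shows "N v = 0"
proof -
  obtain N' where N': "adjoint_pair N N'" "\<And>u. N (N' u) = N' (N u)"
    using assms by (auto simp: normal_op_def)
  have "ip (N v) (N v) = ip v (N' (N v))" using N'(1) by (simp add: adjoint_pair_def)
  also have "\<dots> = 0" using adjoint_kernel[OF N' assms(2)] by simp
  finally show ?thesis by (rule ip_anisotropic)
qed

section \<open>Eigenspaces and spectral decomposition\<close>

definition eig :: "('v \<Rightarrow> 'v) \<Rightarrow> complex \<Rightarrow> 'v set" where
  "eig N z = {v. N v = z *s v}"

text \<open>The complement of \<open>eig N z\<close>, used in place of a projection: membership says
  that a vector has no component for the eigenvalue \<open>z\<close>.\<close>

definition other_eigs :: "('v \<Rightarrow> 'v) \<Rightarrow> complex \<Rightarrow> 'v set" where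
  "other_eigs N z = span (\<Union>e\<in>- {z}. eig N e)"

lemma subspace_eig: "lin N \<Longrightarrow> subspace (eig N z)"
  by (auto simp: eig_def intro!: subspaceI simp: lin_simps scale_right_distrib scale_left_commute)

lemma subspace_other_eigs: "subspace (other_eigs N z)"
  by (simp add: other_eigs_def)

lemma eig_adjoint:
  assumes "adjoint_pair N N'" "\<And>u. N (N' u) = N' (N u)" "v \<in> eig N z"
  shows "N' v = cnj z *s v"
proof -
  have lin: "lin N" "lin N'" using assms(1) by (auto simp: adjoint_pair_def)
  have "N' v - cnj z *s v = 0"
    by (rule adjoint_kernel[OF adjoint_pair_shift[OF assms(1), of z]])
      (use assms(3) in \<open>simp_all add: eig_def assms(2) lin_simps[OF lin(1)] lin_simps[OF lin(2)]
          algebra_simps scale_left_commute\<close>)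
  then show ?thesis by simp
qed

lemma eig_orthogonal:
  assumes "normal_op N" "u \<in> eig N a" "v \<in> eig N b" "a \<noteq> b"
  shows "ip u v = 0"
proof -
  obtain N' where N': "adjoint_pair N N'" "\<And>u. N (N' u) = N' (N u)"
    using assms by (auto simp: normal_op_def)
  have "a * ip u v = ip (N u) v" using assms(2) by (simp add: eig_def ip_scale_left)
  also have "\<dots> = ip u (N' v)" using N'(1) by (simp add: adjoint_pair_def)
  also have "\<dots> = b * ip u v" using eig_adjoint[OF N' assms(3)] by (simp add: ip_scale_right)
  finally show ?thesis using assms(4) by simp
qed

lemma eig_Int_other_eigs:
  assumes "normal_op N" "v \<in> eig N z" "v \<in> other_eigs N z"
  shows "v = 0"
proof -
  have "ip w v = 0" if "w \<in> other_eigs N z" for w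
    using that unfolding other_eigs_def
    by (induction rule: span_induct_alt)
      (auto simp: ip_add_left ip_scale_left intro: eig_orthogonal[OF assms(1) _ assms(2)])
  then show ?thesis using assms(3) ip_anisotropic by blast
qed

text \<open>A factored polynomial in \<open>N\<close>: the product of the operators
  \<open>N - z\<close> over the list, applied to \<open>w\<close>.\<close>

primrec shift_chain :: "('v \<Rightarrow> 'v) \<Rightarrow> complex list \<Rightarrow> 'v \<Rightarrow> 'v" where
  "shift_chain N [] w = w"
| "shift_chain N (z # zs) w = N (shift_chain N zs w) - z *s shift_chain N zs w"

lemma shift_chain_diff_scale:
  "lin N \<Longrightarrow> shift_chain N zs (u - c *s v) = shift_chain N zs u - c *s shift_chain N zs v"
proof (induction zs)
  case (Cons z zs)
  show ?case unfolding shift_chain.simps Cons.IH[OF Cons.prems] lin_simps[OF Cons.prems]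
    by (simp add: algebra_simps scale_left_commute)
qed simp

lemma shift_chain_eig:
  "lin N \<Longrightarrow> u \<in> eig N a \<Longrightarrow> shift_chain N zs u = (\<Prod>z\<leftarrow>zs. a - z) *s u"
  by (induction zs) (auto simp: eig_def lin_simps algebra_simps scale_left_commute)

text \<open>The factors commute, so any of them can be brought to the front.\<close>

lemma shift_chain_remove1:
  assumes "lin N" "z \<in> set zs"
  shows "shift_chain N zs w = shift_chain N (z # remove1 z zs) w"
  using assms(2)
proof (induction zs)
  case (Cons a zs)
  show ?case
  proof (cases "z = a")
    case False
    then have "shift_chain N zs w = shift_chain N (z # remove1 z zs) w" using Cons by auto
    then have e: "shift_chain N zs w = N (shift_chain N (remove1 z zs) w) - z *s shift_chain N (remove1 z zs) w"
      by simp
    have "shift_chain N (z # remove1 z (a # zs)) w =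
        shift_chain N (z # a # remove1 z zs) w" using False by simp
    then show ?thesis unfolding shift_chain.simps e lin_simps[OF assms(1)]
      by (simp add: algebra_simps scale_left_commute)
  qed simp
qed simp

lemma shift_chain_invariant:
  assumes "subspace W" "\<And>w. w \<in> W \<Longrightarrow> N w \<in> W" "w \<in> W"
  shows "shift_chain N zs w \<in> W"
  using assms(3) by (induction zs) (auto intro!: subspace_diff subspace_scale assms(1,2))

text \<open>Factors are dropped one at a time. The vector \<open>u\<close> left by the remaining
  factors is an eigenvector for \<open>z\<close>. If \<open>z\<close> occurs among them again,
  \<open>u\<close> is also in the image of \<open>N - z\<close> and vanishes for lack of Jordan
  blocks. Otherwise they multiply \<open>u\<close> by \<open>c \<noteq> 0\<close>, so they
  annihilate \<open>w\<close> minus \<open>u / c\<close>.\<close>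

lemma eigenvectors_span_of_chain:
  assumes "normal_op N" "subspace W" "\<And>w. w \<in> W \<Longrightarrow> N w \<in> W"
    and "w \<in> W" "shift_chain N zs w = 0"
  shows "w \<in> span (\<Union>z. W \<inter> eig N z)"
  using assms(4,5)
proof (induction zs arbitrary: w)
  case Nil
  then show ?case by (simp add: span_zero)
next
  case (Cons z zs)
  note lin = normal_op_linear[OF assms(1)]
  define u where "u = shift_chain N zs w"
  have u: "u \<in> W" "u \<in> eig N z"
    using Cons.prems shift_chain_invariant[OF assms(2,3)] by (auto simp: u_def eig_def)
  show ?case
  proof (cases "z \<in> set zs")
    case True
    let ?r = "shift_chain N (remove1 z zs) w"
    have "u = N ?r - z *s ?r"
      unfolding u_def shift_chain_remove1[OF lin True] by simp
    moreover have "N u - z *s u = 0" using u by (simp add: eig_def)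
    ultimately have "u = 0"
      using normal_op_kernel_square[OF normal_op_shift[OF assms(1), of z], where v = ?r] by simp
    then show ?thesis using Cons by (simp add: u_def)
  next
    case False
    define c where "c = (\<Prod>x\<leftarrow>zs. z - x)"
    have "c \<noteq> 0" using False by (auto simp: c_def prod_list_zero_iff)
    define w' where "w' = w - (1 / c) *s u"
    have "shift_chain N zs w' = 0"
      unfolding w'_def shift_chain_diff_scale[OF lin] shift_chain_eig[OF lin u(2)] c_def[symmetric]
      using \<open>c \<noteq> 0\<close> by (simp add: u_def)
    moreover have "w' \<in> W" unfolding w'_def using Cons.prems u by (intro subspace_diff subspace_scale assms(2))
    ultimately have "w' \<in> span (\<Union>z. W \<inter> eig N z)" using Cons.IH by blast
    moreover have "u \<in> span (\<Union>z. W \<inter> eig N z)" using u by (intro span_base) blast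
    moreover have "w = w' + (1 / c) *s u" by (simp add: w'_def)
    ultimately show ?thesis by (metis span_add span_scale)
  qed
qed

definition poly_app :: "('v \<Rightarrow> 'v) \<Rightarrow> complex poly \<Rightarrow> 'v \<Rightarrow> 'v" where
  "poly_app N p w = (\<Sum>i\<le>degree p. coeff p i *s (N ^^ i) w)"

lemma poly_app_eq:
  assumes "degree p \<le> n"
  shows "poly_app N p w = (\<Sum>i\<le>n. coeff p i *s (N ^^ i) w)"
  unfolding poly_app_def
  by (rule sum.mono_neutral_left) (use assms in \<open>auto intro: coeff_eq_0\<close>)

lemma poly_app_linear_factor:
  assumes "lin N"
  shows "poly_app N ([:- z, 1:] * q) w = N (poly_app N q w) - z *s poly_app N q w"
proof -
  let ?n = "degree q"
  have e: "[:- z, 1:] * q = smult (- z) q + pCons 0 q" by simp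
  have "degree ([:- z, 1:] * q) \<le> Suc ?n" unfolding e
    by (intro degree_add_le) (auto intro: degree_smult_le[THEN order_trans] degree_pCons_le)
  then have "poly_app N ([:- z, 1:] * q) w =
     (\<Sum>i\<le>Suc ?n. coeff (pCons 0 q) i *s (N ^^ i) w) + (\<Sum>i\<le>Suc ?n. (- z * coeff q i) *s (N ^^ i) w)"
    by (subst poly_app_eq) (auto simp: e scale_left_diff_distrib sum.distrib[symmetric] add.commute
        simp del: sum.atMost_Suc)
  also have "(\<Sum>i\<le>Suc ?n. coeff (pCons 0 q) i *s (N ^^ i) w) = N (poly_app N q w)"
    by (subst sum.atMost_Suc_shift) (simp add: poly_app_def lin_simps[OF assms])
  also have "(\<Sum>i\<le>Suc ?n. (- z * coeff q i) *s (N ^^ i) w) = - (z *s poly_app N q w)"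
    by (subst poly_app_eq[of q "Suc ?n"]) (simp_all add: scale_sum_right sum_negf[symmetric] del: sum.atMost_Suc)
  finally show ?thesis by simp
qed

lemma poly_app_chain:
  assumes "lin N" "p \<noteq> 0"
  shows "\<exists>c zs. c \<noteq> 0 \<and> (\<forall>w. poly_app N p w = c *s shift_chain N zs w)"
  using assms(2)
proof (induction "degree p" arbitrary: p)
  case 0
  then obtain c where "p = [:c:]" by (metis degree_0_id)
  with 0 show ?case by (intro exI[of _ c] exI[of _ "[]"]) (simp add: poly_app_def)
next
  case (Suc n)
  then obtain z where "poly p z = 0"
    by (metis constant_degree fundamental_theorem_of_algebra nat.distinct(1))
  then obtain q where q: "p = [:- z, 1:] * q" using poly_eq_0_iff_dvd by blast
  with Suc have "q \<noteq> 0" "degree q = n" by (auto simp: degree_mult_eq simp del: mult_pCons_left)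
  with Suc(1) obtain c zs where "c \<noteq> 0" "\<forall>w. poly_app N q w = c *s shift_chain N zs w" by metis
  moreover from this have "poly_app N p w = c *s shift_chain N (z # zs) w" for w
    unfolding q poly_app_linear_factor[OF assms(1)]
    by (simp add: lin_simps[OF assms(1)] scale_right_diff_distrib mult.commute)
  ultimately show ?case by blast
qed

text \<open>In finite dimension the vectors obtained from \<open>w\<close> by powers of
  \<open>N\<close> cannot stay independent; a relation gives a monic polynomial, which splits into
  linear factors over the complex numbers.\<close>

lemma ex_annihilating_chain:
  assumes "lin N"
  shows "\<exists>zs. shift_chain N zs w = 0"
proof -
  define g where "g = (\<lambda>i. (N ^^ i) w)"
  have "\<exists>m. g m \<in> span (g ` {..<m})"
  proof (rule ccontr)
    assume *: "\<nexists>m. g m \<in> span (g ` {..<m})"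
    have "independent (g ` {..<m}) \<and> card (g ` {..<m}) = m" for m
    proof (induction m)
      case 0
      then show ?case by (simp add: independent_empty)
    next
      case (Suc m)
      have new: "g m \<notin> span (g ` {..<m})" using * by simp
      then have "g m \<notin> g ` {..<m}" using span_superset by (meson subsetD)
      then have "card (g ` {..<Suc m}) = Suc m" using Suc.IH by (simp add: lessThan_Suc)
      moreover have "independent (g ` {..<Suc m})"
        unfolding lessThan_Suc image_insert using Suc.IH new by (intro independent_insertI) auto
      ultimately show ?case by blast
    qed
    then have "card (g ` {..<Suc dimension}) \<le> dimension" "card (g ` {..<Suc dimension}) = Suc dimension"
      by (metis dim_eq_card_independent dim_subset_UNIV, blast)
    then show False by simp
  qed
  then obtain m where m: "g m \<in> span (g ` {..<m})" by blast
  have "\<exists>c. v = (\<Sum>i<m. c i *s g i)" if "v \<in> span (g ` {..<m})" for v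
    using that
  proof (induction rule: span_induct_alt)
    case base
    show ?case by (rule exI[of _ "\<lambda>_. 0"]) simp
  next
    case (step a x y)
    then obtain j c where j: "j < m" "x = g j" "y = (\<Sum>i<m. c i *s g i)" by auto
    have "a *s x + y = (\<Sum>i<m. ((if i = j then a else 0) + c i) *s g i)"
      using j by (simp add: scale_left_distrib sum.distrib if_distrib[of "\<lambda>x. x *s _"] cong: if_cong)
    then show ?case by (rule exI[where x = "\<lambda>i. (if i = j then a else 0) + c i"])
  qed
  with m obtain c where c: "g m = (\<Sum>i<m. c i *s g i)" by blast
  define p where "p = monom 1 m - (\<Sum>i<m. monom (c i) i)"
  have co: "coeff p i = (if i = m then 1 else if i < m then - c i else 0)" for i
    by (simp add: p_def coeff_sum)
  have "p \<noteq> 0" using co[of m] by auto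
  have "degree p \<le> m" by (rule degree_le) (simp add: co)
  have "poly_app N p w = (\<Sum>i<m. - (c i *s g i)) + g m"
    by (subst poly_app_eq[OF \<open>degree p \<le> m\<close>])
      (simp add: lessThan_Suc_atMost[symmetric] co g_def)
  also have "\<dots> = 0" unfolding c by (simp add: sum_negf)
  finally show ?thesis using poly_app_chain[OF assms \<open>p \<noteq> 0\<close>] by (metis scale_eq_0_iff)
qed

lemma normal_op_span:
  assumes "normal_op N" "subspace W" "\<And>w. w \<in> W \<Longrightarrow> N w \<in> W" "w \<in> W"
  shows "w \<in> span (\<Union>z. W \<inter> eig N z)"
  using ex_annihilating_chain[OF normal_op_linear[OF assms(1)], of w]
    eigenvectors_span_of_chain[OF assms] by blast

lemma span_eigs_split:
  assumes "normal_op N" "subspace W" "w \<in> span (\<Union>z\<in>Z. W \<inter> eig N z)"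
  shows "\<exists>x y. w = x + y \<and> x \<in> W \<inter> eig N d \<and> y \<in> other_eigs N d"
  using assms(3)
proof (induction rule: span_induct_alt)
  case base
  show ?case using normal_op_linear[OF assms(1)]
    by (intro exI[of _ 0]) (simp add: subspace_0 assms(2) subspace_eig subspace_other_eigs)
next
  case (step c v w)
  then obtain z x y where v: "v \<in> W" "v \<in> eig N z" and w: "w = x + y" "x \<in> W \<inter> eig N d" "y \<in> other_eigs N d"
    by blast
  note S = subspace_eig[OF normal_op_linear[OF assms(1)]] subspace_other_eigs assms(2)
  show ?case
  proof (cases "z = d")
    case True
    then show ?thesis using v w S
      by (intro exI[of _ "c *s v + x"] exI[of _ y]) (auto intro!: subspace_add subspace_scale)
  next
    case False
    then have "v \<in> other_eigs N d" using v by (auto simp: other_eigs_def intro: span_base)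
    then show ?thesis using w S
      by (intro exI[of _ x] exI[of _ "c *s v + y"]) (auto intro!: subspace_add subspace_scale)
  qed
qed

text \<open>In a decomposition of \<open>w\<close> into eigenvectors, the one for
  \<open>z \<noteq> d\<close> is a difference of vectors without \<open>z\<close>-component, and
  therefore 0.\<close>

lemma other_eigs_all_imp_eig:
  assumes "normal_op N" "\<And>e. e \<noteq> d \<Longrightarrow> w \<in> other_eigs N e"
  shows "w \<in> eig N d"
proof -
  note S = subspace_eig[OF normal_op_linear[OF assms(1)]] subspace_other_eigs
  have "w \<in> span (\<Union>z. UNIV \<inter> eig N z)" using normal_op_span[OF assms(1) subspace_UNIV] by simp
  then have "\<exists>F a. finite F \<and> (\<forall>z. a z \<in> eig N z) \<and> w = (\<Sum>z\<in>F. a z)"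
  proof (induction rule: span_induct_alt)
    case base
    show ?case using S by (intro exI[of _ "{}"] exI[of _ "\<lambda>_. 0"]) (auto intro: subspace_0)
  next
    case (step c v w)
    then obtain y F a where y: "v \<in> eig N y" and F: "finite F" "\<forall>z. a z \<in> eig N z" "w = (\<Sum>z\<in>F. a z)" by blast
    \<comment> \<open>The eigenvalue \<open>y\<close> may or may not occur in \<open>F\<close>
      already; the two conditionals handle both cases.\<close>
    define b where "b = (\<lambda>z. (if z = y then c *s v else 0) + (if z \<in> F then a z else 0))"
    have "\<forall>z. b z \<in> eig N z" using y F S by (auto simp: b_def intro!: subspace_add subspace_scale subspace_0)
    moreover have "(\<Sum>z\<in>insert y F. b z) = c *s v + w"
      using F by (auto simp: b_def sum.distrib sum.delta sum.If_cases Int_insert_left insert_absorb)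
    ultimately show ?case using F(1) by (metis finite_insert)
  qed
  then obtain F a where F: "finite F" "\<And>z. a z \<in> eig N z" "w = (\<Sum>z\<in>F. a z)" by blast
  have "a z = 0" if z: "z \<in> F" "z \<noteq> d" for z
  proof -
    have "a z = w - (\<Sum>x\<in>F - {z}. a x)" using F z by (simp add: sum.remove)
    moreover have "a x \<in> other_eigs N z" if "x \<in> F - {z}" for x
      using F(2)[of x] that by (auto simp: other_eigs_def intro: span_base)
    ultimately have "a z \<in> other_eigs N z"
      using assms(2)[OF z(2)] S by (auto intro!: subspace_diff subspace_sum)
    with F(2) show ?thesis using eig_Int_other_eigs[OF assms(1)] by blast
  qed
  then have "w = (if d \<in> F then a d else 0)" using F(1,3)
    by (auto simp: sum.remove[of F d] intro: sum.neutral)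
  then show ?thesis using F(2) S(1) subspace_0 by auto
qed

lemma dim_span_eigs:
  assumes "normal_op N" "subspace U" "finite Z"
  shows "dim (span (\<Union>z\<in>Z. U \<inter> eig N z)) = (\<Sum>z\<in>Z. dim (U \<inter> eig N z))"
  using assms(3)
proof (induction Z rule: finite_induct)
  case empty
  then show ?case by simp
next
  case (insert y Z)
  let ?A = "U \<inter> eig N y" and ?B = "span (\<Union>z\<in>Z. U \<inter> eig N z)"
  have A: "subspace ?A" using assms subspace_eig normal_op_linear subspace_inter by blast
  have "?B \<subseteq> other_eigs N y" unfolding other_eigs_def using insert by (intro span_mono) auto
  then have "?A \<inter> ?B = {0}"
    using eig_Int_other_eigs[OF assms(1)] subspace_0[OF A] span_zero by blast
  moreover have "span (\<Union>z\<in>insert y Z. U \<inter> eig N z) = {x + b | x b. x \<in> ?A \<and> b \<in> ?B}"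
    using A by (simp add: span_Un) (simp add: span_eq_iff[THEN iffD2])
  ultimately show ?case using dim_sums_Int[OF A subspace_span, of "\<Union>z\<in>Z. U \<inter> eig N z"] insert by simp
qed

lemma finite_spectrum:
  assumes "normal_op N" "subspace U"
  shows "finite {z. U \<inter> eig N z \<noteq> {0}}"
proof (rule ccontr)
  assume "infinite {z. U \<inter> eig N z \<noteq> {0}}"
  then obtain Z where Z: "Z \<subseteq> {z. U \<inter> eig N z \<noteq> {0}}" "finite Z" "card Z = Suc dimension"
    using infinite_arbitrarily_large by blast
  have "dim (U \<inter> eig N z) \<ge> 1" if "z \<in> Z" for z
  proof -
    have "0 \<in> U \<inter> eig N z"
      using assms subspace_eig normal_op_linear subspace_0 by blast
    with that Z(1) have "\<not> U \<inter> eig N z \<subseteq> {0}" by blast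
    then have "dim (U \<inter> eig N z) \<noteq> 0" by simp
    then show ?thesis by linarith
  qed
  then have "card Z \<le> (\<Sum>z\<in>Z. dim (U \<inter> eig N z))" using sum_mono[of Z "\<lambda>_. 1" "\<lambda>z. dim (U \<inter> eig N z)"] by simp
  also have "\<dots> \<le> dimension"
    unfolding dim_span_eigs[OF assms Z(2), symmetric] by (rule dim_subset_UNIV)
  finally show False using Z by simp
qed

lemma dim_eq_sum_eigs:
  assumes "normal_op N" "subspace U" "\<And>u. u \<in> U \<Longrightarrow> N u \<in> U"
  shows "dim U = (\<Sum>z\<in>{z. U \<inter> eig N z \<noteq> {0}}. dim (U \<inter> eig N z))"
proof -
  have "(\<Union>z. U \<inter> eig N z) \<subseteq> span (\<Union>z\<in>{z. U \<inter> eig N z \<noteq> {0}}. U \<inter> eig N z)"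
    by (auto intro: span_base) (metis (mono_tags, lifting) IntI UN_I mem_Collect_eq singletonD span_base span_zero)
  then have "U = span (\<Union>z\<in>{z. U \<inter> eig N z \<noteq> {0}}. U \<inter> eig N z)"
    using normal_op_span[OF assms] assms(2)
    by (intro equalityI subsetI) (meson span_minimal subsetD subspace_span, metis (no_types, lifting) UN_subset_iff inf_le1 span_minimal subsetD)
  then show ?thesis using dim_span_eigs[OF assms(1,2) finite_spectrum[OF assms(1,2)]] by metis
qed

end

section \<open>Jucys--Murphy operators\<close>

primrec slide_path :: "int list \<Rightarrow> int set \<Rightarrow> bool" where
  "slide_path [] Y \<longleftrightarrow> Y = vacuum"
| "slide_path (p # ps) Y \<longleftrightarrow> p \<in> movable 2 Y \<and> slide_path ps (slide 2 p Y)"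

lemma slide_inject:
  assumes "p \<in> movable s Y" "p \<in> movable s Y'" "slide s p Y = slide s p Y'"
  shows "Y = Y'"
proof -
  have "X = insert p (slide s p X - {p - s})" if "p \<in> movable s X" for X
    using that by (auto simp: movable_def slide_def)
  with assms show ?thesis by metis
qed

text \<open>Every slide can be undone, so a path rebuilds its diagram from
  \<open>vacuum\<close>.\<close>

lemma slide_path_unique: "slide_path ps Y \<Longrightarrow> slide_path ps Y' \<Longrightarrow> Y = Y'"
proof (induction ps arbitrary: Y Y')
  case (Cons p ps)
  then show ?case by (metis slide_inject slide_path.simps(2))
qed simp

text \<open>Any removable box may be removed first: if the path begins with another bead
  \<open>q\<close>, then \<open>p\<close> is still movable afterwards, and the two slides commute.
  In \<open>vacuum\<close> no bead can move.\<close>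

lemma slide_path_last:
  assumes "slide_path ps Y" "p \<in> movable 2 Y"
  shows "\<exists>qs. slide_path (p # qs) Y \<and> Suc (length qs) = length ps"
  using assms
proof (induction ps arbitrary: Y)
  case Nil
  then show ?case by (auto simp: movable_def vacuum_def)
next
  case (Cons q ps)
  show ?case
  proof (cases "q = p")
    case False
    have pq: "p \<in> Y" "p - 2 \<notin> Y" "q \<in> Y" "q - 2 \<notin> Y"
      using Cons.prems by (auto simp: movable_def)
    have ne: "p - 2 \<noteq> q" "q - 2 \<noteq> p" "p - 2 \<noteq> q - 2" using pq False by auto
    have p: "p \<in> movable 2 (slide 2 q Y)" and q: "q \<in> movable 2 (slide 2 p Y)"
      using pq ne False by (auto simp: movable_def slide_def)
    have "slide 2 p (slide 2 q Y) = slide 2 q (slide 2 p Y)"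
      using pq ne False unfolding slide_def by blast
    moreover obtain qs where "slide_path (p # qs) (slide 2 q Y)" "Suc (length qs) = length ps"
      using Cons.IH[OF _ p] Cons.prems by auto
    ultimately have "slide_path (p # q # qs) Y" using Cons.prems q by simp
    then show ?thesis using \<open>Suc (length qs) = length ps\<close> by (intro exI[of _ "q # qs"]) simp
  qed (use Cons in auto)
qed

text \<open>
  The slide starting at position \<open>2 * c + e\<close> removes a box of content \<open>c\<close> from the \<open>e\<close>-th component
  of a bipartition; its label collects the eigenvalues of a Jucys--Murphy operator (real part) and of a
  sign change (imaginary part).
\<close>

definition label :: "int \<Rightarrow> complex" where
  "label p = Complex (of_int (p div 2)) (if even p then 1 else - 1)"

lemma inj_label: "inj label"
  by (rule injI) (simp add: label_def split: if_splits, (metis even_two_times_div_two odd_two_times_div_two_succ)+)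

lemma label_eq_iff [simp]: "label p = label q \<longleftrightarrow> p = q"
  using inj_label by (simp add: inj_eq)

lemma label_add_2: "label (p + 2) = label p + 1"
  by (simp add: label_def complex_eq_iff)

lemma label_diff_2: "label (p - 2) = label p - 1"
  using label_add_2[of "p - 2"] by simp

lemma label_adjacent_iff: "label p - label q \<in> {1, - 1} \<longleftrightarrow> p = q + 2 \<or> p = q - 2"
proof -
  have "label p - label q = 1 \<longleftrightarrow> label p = label (q + 2)"
    and "label p - label q = - 1 \<longleftrightarrow> label p = label (q - 2)"
    unfolding label_add_2 label_diff_2 by (auto simp: algebra_simps)
  then show ?thesis by simp
qed

text \<open>
  \<open>G k\<close> is the set of operators by which the \<open>k\<close>-th hyperoctahedral group acts, \<open>s k\<close> exchanges the
  coordinates \<open>k\<close> and \<open>k + 1\<close>, and \<open>t k\<close> changes the sign of the \<open>k\<close>-th one.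
\<close>

locale hyperoctahedral_tower = hermitian_space scale Basis ip
  for scale :: "complex \<Rightarrow> 'v::ab_group_add \<Rightarrow> 'v" (infixr \<open>*s\<close> 75) and Basis ip +
  fixes n :: nat and G :: "nat \<Rightarrow> ('v \<Rightarrow> 'v) set" and s t :: "nat \<Rightarrow> 'v \<Rightarrow> 'v"
  assumes G_linear: "k \<le> n \<Longrightarrow> g \<in> G k \<Longrightarrow> lin g"
    and G_0: "G 0 = {id}"
    and G_comp: "k \<le> n \<Longrightarrow> g \<in> G k \<Longrightarrow> h \<in> G k \<Longrightarrow> g \<circ> h \<in> G k"
    and G_Suc: "k < n \<Longrightarrow> G k \<subseteq> G (Suc k)"
    and t_in_G: "k < n \<Longrightarrow> t (Suc k) \<in> G (Suc k)"
    and s_in_G: "0 < k \<Longrightarrow> k < n \<Longrightarrow> s k \<in> G (Suc k)"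
    and G_decompose: "k < n \<Longrightarrow> g \<in> G (Suc k) \<Longrightarrow>
      \<exists>h h'. h \<in> G k \<and> h' \<in> G k \<and> (g = h \<or> g = t (Suc k) \<circ> h \<or>
        0 < k \<and> (g = h \<circ> s k \<circ> h' \<or> g = t (Suc k) \<circ> (h \<circ> s k \<circ> h')))"
    and s_selfadjoint: "0 < k \<Longrightarrow> k < n \<Longrightarrow> ip (s k u) v = ip u (s k v)"
    and t_selfadjoint: "0 < k \<Longrightarrow> k \<le> n \<Longrightarrow> ip (t k u) v = ip u (t k v)"
    and s_s: "0 < k \<Longrightarrow> k < n \<Longrightarrow> s k (s k v) = v"
    and t_t: "0 < k \<Longrightarrow> k \<le> n \<Longrightarrow> t k (t k v) = v"
    and s_t: "0 < k \<Longrightarrow> k < n \<Longrightarrow> s k (t k v) = t (Suc k) (s k v)"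
    and braid: "0 < k \<Longrightarrow> Suc k < n \<Longrightarrow> s k (s (Suc k) (s k v)) = s (Suc k) (s k (s (Suc k) v))"
    and s_comm: "Suc k < n \<Longrightarrow> g \<in> G k \<Longrightarrow> s (Suc k) (g v) = g (s (Suc k) v)"
    and t_comm: "k < n \<Longrightarrow> g \<in> G k \<Longrightarrow> t (Suc k) (g v) = g (t (Suc k) v)"
begin

lemma G_mono: "j \<le> k \<Longrightarrow> k \<le> n \<Longrightarrow> G j \<subseteq> G k"
proof (induction k rule: dec_induct)
  case (step m)
  then show ?case using G_Suc[of m] by auto
qed simp

lemma id_in_G: "k \<le> n \<Longrightarrow> id \<in> G k"
  using G_mono[of 0 k] G_0 by auto

lemma s_in_G': "0 < j \<Longrightarrow> j < k \<Longrightarrow> k \<le> n \<Longrightarrow> s j \<in> G k"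
  using s_in_G[of j] G_mono[of "Suc j" k] by auto

lemma t_in_G': "0 < j \<Longrightarrow> j \<le> k \<Longrightarrow> k \<le> n \<Longrightarrow> t j \<in> G k"
  using t_in_G[of "j - 1"] G_mono[of j k] by auto

lemma lin_s: "0 < k \<Longrightarrow> k < n \<Longrightarrow> lin (s k)"
  using G_linear[OF _ s_in_G] by simp

lemma lin_t: "0 < k \<Longrightarrow> k \<le> n \<Longrightarrow> lin (t k)"
  using G_linear[of k "t k"] t_in_G'[of k k] by simp

lemma s_t': "0 < k \<Longrightarrow> k < n \<Longrightarrow> s k (t (Suc k) v) = t k (s k v)"
  using s_t[of k "s k v"] s_s by metis

lemma t_t_comm: "0 < k \<Longrightarrow> k < n \<Longrightarrow> t (Suc k) (t k v) = t k (t (Suc k) v)"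
  by (rule t_comm) (auto intro: t_in_G')

text \<open>Unfolded, this is half the sum, over \<open>0 < i < k\<close>, of the transposition of
  \<open>i\<close> and \<open>k\<close> and its product with \<open>t i\<close> and
  \<open>t k\<close>. The factor \<open>1 / 2\<close> turns the correction term into the projection
  onto equal signs, and the eigenvalues into contents instead of their doubles.\<close>

primrec jm :: "nat \<Rightarrow> 'v \<Rightarrow> 'v" where
  "jm 0 v = 0"
| "jm (Suc k) v = (if k = 0 then 0
     else s k (jm k (s k v)) + (1 / 2) *s (s k v + t k (t (Suc k) (s k v))))"

lemma lin_jm: "k \<le> n \<Longrightarrow> lin (jm k)"
proof (induction k)
  case (Suc k)
  then show ?case
  proof (cases "k = 0")
    case False
    then have "lin (s k)" "lin (t k)" "lin (t (Suc k))" "lin (jm k)"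
      using Suc lin_s lin_t by auto
    then show ?thesis using False by (simp add: lin_iff scale_right_distrib scale_left_commute algebra_simps)
  qed (simp add: lin_iff)
qed (simp add: lin_iff)

lemma jm_commute:
  assumes "k \<le> n" "lin c" "\<And>i v. 0 < i \<Longrightarrow> i < k \<Longrightarrow> c (s i v) = s i (c v)"
    and "\<And>i v. 0 < i \<Longrightarrow> i \<le> k \<Longrightarrow> c (t i v) = t i (c v)"
  shows "c (jm k v) = jm k (c v)"
  using assms(1,3,4)
proof (induction k arbitrary: v)
  case (Suc k)
  then show ?case using lin_simps[OF assms(2)] by (cases "k = 0") auto
qed (simp add: lin_simps[OF assms(2)])

lemma jm_commute_G:
  assumes "k \<le> n" "j \<le> k" "lin c" "\<And>g v. g \<in> G k \<Longrightarrow> c (g v) = g (c v)"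
  shows "c (jm j v) = jm j (c v)"
  by (rule jm_commute) (use assms s_in_G' t_in_G' in auto)

text \<open>Together with \<open>jm_s\<close> this is a relation of degenerate affine Hecke type:
  \<open>s k\<close> exchanges \<open>jm k\<close> and \<open>jm (Suc k)\<close> up to the
  projection onto equal signs of the coordinates \<open>k\<close> and \<open>Suc k\<close>.\<close>

lemma s_jm: "0 < k \<Longrightarrow> k < n \<Longrightarrow>
    jm (Suc k) (s k v) = s k (jm k v) + (1 / 2) *s (v + t k (t (Suc k) v))"
  by (simp add: s_s)

lemma jm_s: "0 < k \<Longrightarrow> k < n \<Longrightarrow>
    jm k (s k v) = s k (jm (Suc k) v) - (1 / 2) *s (v + t k (t (Suc k) v))"
  using lin_simps[OF lin_s, of k] by (simp add: s_s s_t s_t' t_t_comm)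

declare jm.simps(2) [simp del]

text \<open>By \<open>G_decompose\<close>, commuting with \<open>G k\<close> for
  \<open>k = Suc j\<close> reduces to commuting with \<open>G j\<close>, \<open>t k\<close> and
  \<open>s j\<close>. Only \<open>s j\<close> needs the braid relation.\<close>

lemma jm_commute_Suc:
  "k < n \<Longrightarrow> (\<forall>g\<in>G k. \<forall>v. g (jm (Suc k) v) = jm (Suc k) (g v)) \<and>
     (\<forall>v. t (Suc k) (jm (Suc k) v) = jm (Suc k) (t (Suc k) v))"
proof (induction k)
  case 0
  then show ?case using lin_t[of 1] G_linear[of 0] by (auto simp: lin_simps jm.simps(2))
next
  case (Suc j)
  define k where "k = Suc j"
  have k: "0 < k" "k < n" using Suc by (auto simp: k_def)
  have IH: "\<And>g v. g \<in> G j \<Longrightarrow> g (jm k v) = jm k (g v)" "\<And>v. t k (jm k v) = jm k (t k v)"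
    using Suc by (auto simp: k_def)
  note ls = lin_simps[OF lin_s[OF k]]
  have tlin: "lin (t k)" "lin (t (Suc k))" using lin_t k by auto
  note lt = lin_simps[OF tlin(1)] lin_simps[OF tlin(2)]
  have t_jm: "t (Suc k) (jm k v) = jm k (t (Suc k) v)" for v
    by (rule jm_commute_G[of k]) (use k tlin t_comm in auto)
  have eq: "jm (Suc k) v = s k (jm k (s k v)) + (1 / 2) *s (s k v + t k (t (Suc k) (s k v)))" for v
    using k by (simp add: jm.simps(2))
  note tt = t_t[OF k(1) less_imp_le[OF k(2)]] t_t[of "Suc k", OF zero_less_Suc Suc_leI[OF k(2)]]
  have T1: "t (Suc k) (jm (Suc k) v) = jm (Suc k) (t (Suc k) v)" for v
    unfolding eq by (simp add: lt s_t s_t' IH(2)[symmetric] tt t_t_comm k)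
  have T0: "t k (jm (Suc k) v) = jm (Suc k) (t k v)" for v
    unfolding eq
    by (simp add: lt s_t s_t' t_jm[symmetric] tt t_t_comm k add.commute)
  have A: "h (jm (Suc k) v) = jm (Suc k) (h v)" if h: "h \<in> G j" for h v
  proof -
    have hl: "lin h" using G_linear[of j] h k by (simp add: k_def)
    have "s k (h v) = h (s k v)" for v using s_comm[of j h] h k by (simp add: k_def)
    moreover have "t k (h v) = h (t k v)" for v using t_comm[of j h] h k by (simp add: k_def)
    moreover have "t (Suc k) (h v) = h (t (Suc k) v)" for v
      using t_comm[of k h] h k G_mono[of j k] by (auto simp: k_def)
    ultimately show ?thesis unfolding eq by (simp add: lin_simps[OF hl] IH(1)[OF h, symmetric])
  qed
  have S: "s j (jm (Suc k) v) = jm (Suc k) (s j v)" if j: "0 < j" for v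
  proof -
    have jn: "j < n" using k by (simp add: k_def)
    note lj = lin_simps[OF lin_s[OF j jn]]
    have br: "s j (s k (s j v)) = s k (s j (s k v))" for v
      using braid[OF j] k by (simp add: k_def)
    have c: "s k (jm j v) = jm j (s k v)" for v
      by (rule jm_commute_G[of j]) (use k lin_s s_comm[of j] in \<open>auto simp: k_def\<close>)
    have tj: "t (Suc k) (s j v) = s j (t (Suc k) v)" for v
      by (rule t_comm) (use s_in_G'[of j k] j k in \<open>auto simp: k_def\<close>)
    have sj: "s j (t j v) = t k (s j v)" "s j (t k v) = t j (s j v)" for v
      using s_t[OF j jn] s_t'[OF j jn] by (simp_all add: k_def)
    have st: "s k (t j v) = t j (s k v)" for v
      using s_comm[of j "t j"] t_in_G'[of j j] j k by (simp add: k_def)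
    have jmk: "jm k v = s j (jm j (s j v)) + (1 / 2) *s (s j v + t j (t k (s j v)))" for v
      using j by (simp add: k_def jm.simps(2))
    \<comment> \<open>Two levels are unfolded. The last two lines belong to the transpositions of
      \<open>Suc k\<close> with \<open>j\<close> and with \<open>k\<close>; commuting with
      \<open>s j\<close> exchanges them, and the braid relation carries \<open>s j\<close> through
      the first line.\<close>
    have main: "jm (Suc k) v = s k (s j (jm j (s j (s k v))))
        + (1 / 2) *s (s k (s j (s k v)) + t j (t (Suc k) (s k (s j (s k v)))))
        + (1 / 2) *s (s k v + t k (t (Suc k) (s k v)))" for v
      unfolding eq jmk by (simp add: ls st s_t k)
    have "s j (jm (Suc k) v) = s j (s k (s j (jm j (s j (s k v)))))
        + (1 / 2) *s (s j (s k (s j (s k v))) + t k (t (Suc k) (s j (s k (s j (s k v))))))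
        + (1 / 2) *s (s j (s k v) + t j (t (Suc k) (s j (s k v))))"
      unfolding main by (simp add: lj sj tj)
    moreover have "s j (s k (s j (s k v))) = s k (s j v)"
      by (simp add: br s_s k)
    moreover have "s j (s k (s j (jm j (s j (s k v))))) = s k (s j (jm j (s j (s k (s j v)))))"
      by (simp add: br c)
    moreover have "s k (s j (s k (s j v))) = s j (s k v)"
      by (metis br s_s j jn)
    ultimately show ?thesis unfolding main by (simp add: add_ac)
  qed
  have "g (jm (Suc k) v) = jm (Suc k) (g v)" if g: "g \<in> G k" for g v
  proof -
    obtain h h' where h: "h \<in> G j" "h' \<in> G j" and
      "g = h \<or> g = t k \<circ> h \<or> 0 < j \<and> (g = h \<circ> s j \<circ> h' \<or> g = t k \<circ> (h \<circ> s j \<circ> h'))"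
      using G_decompose[of j g] g k unfolding k_def by auto
    then show ?thesis by (elim disjE conjE) (simp_all add: A[OF h(1)] A[OF h(2)] T0 S)
  qed
  then show ?case using T1 unfolding k_def by blast
qed

lemma jm_selfadjoint: "k \<le> n \<Longrightarrow> ip (jm k u) v = ip u (jm k v)"
proof (induction k arbitrary: u v)
  case (Suc k)
  have "ip (t k (t (Suc k) (s k u))) v = ip u (t k (t (Suc k) (s k v)))" if "0 < k"
    using that Suc.prems
    by (simp add: t_selfadjoint s_selfadjoint) (simp add: s_t s_t' t_t_comm)
  then show ?case using Suc
    by (simp add: ip_add_left ip_add_right ip_scale_left ip_scale_right s_selfadjoint jm.simps(2))
qed simp

text \<open>
  Jucys--Murphy operator and sign change are self-adjoint, hence joint eigenvectors with eigenvalues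
  \<open>(a, b)\<close> are the eigenvectors of one normal operator for the eigenvalue \<open>a + \<i> b\<close>.
\<close>

definition wop :: "nat \<Rightarrow> 'v \<Rightarrow> 'v" where
  "wop k v = jm k v + \<i> *s t k v"

abbreviation weig :: "nat \<Rightarrow> complex \<Rightarrow> 'v set" where "weig k \<equiv> eig (wop k)"

lemma t_jm_commute: "0 < k \<Longrightarrow> k \<le> n \<Longrightarrow> t k (jm k v) = jm k (t k v)"
  using jm_commute_Suc[of "k - 1"] by simp

lemma wop_adjoint:
  assumes "0 < k" "k \<le> n"
  shows "adjoint_pair (wop k) (\<lambda>v. jm k v - \<i> *s t k v)"
    and "wop k (jm k v - \<i> *s t k v) = jm k (wop k v) - \<i> *s t k (wop k v)"
proof -
  have l: "lin (jm k)" "lin (t k)" using assms lin_jm lin_t by auto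
  show "adjoint_pair (wop k) (\<lambda>v. jm k v - \<i> *s t k v)"
    using l assms
    by (simp add: adjoint_pair_def lin_iff wop_def ip_add_left ip_diff_right ip_scale_left
        ip_scale_right jm_selfadjoint t_selfadjoint)
      (simp add: scale_right_distrib scale_right_diff_distrib scale_left_commute algebra_simps)
  show "wop k (jm k v - \<i> *s t k v) = jm k (wop k v) - \<i> *s t k (wop k v)"
    by (simp add: wop_def lin_simps[OF l(1)] lin_simps[OF l(2)] t_jm_commute assms t_t
        scale_right_distrib scale_right_diff_distrib)
qed

section \<open>Joint eigenvectors and adjacent transpositions\<close>

lemma normal_wop: "0 < k \<Longrightarrow> k \<le> n \<Longrightarrow> normal_op (wop k)"
  unfolding normal_op_def using wop_adjoint by blast

text \<open>The adjoint of \<open>wop k\<close> acts on \<open>v\<close> by \<open>cnj z\<close>.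
  Adding the two eigenvalue equations isolates \<open>jm k\<close>, and the rest is
  \<open>t k\<close>.\<close>

lemma weig_jm_t:
  assumes "0 < k" "k \<le> n" "v \<in> weig k z"
  shows "jm k v = complex_of_real (Re z) *s v" "t k v = complex_of_real (Im z) *s v"
proof -
  have 1: "jm k v + \<i> *s t k v = z *s v" using assms(3) by (simp add: eig_def wop_def)
  have 2: "jm k v - \<i> *s t k v = cnj z *s v"
    using eig_adjoint[OF wop_adjoint(1)[OF assms(1,2)] _ assms(3)] wop_adjoint(2)[OF assms(1,2)] by simp
  have "2 *s jm k v = (z + cnj z) *s v"
    unfolding scale_left_distrib using 1 2 by (metis add_diff_cancel_left' diff_add_cancel add_diff_eq add.commute scale_left_distrib scale_one one_add_one diff_add_eq)
  then have "(1/2) *s (2 *s jm k v) = (1/2) *s ((2 * complex_of_real (Re z)) *s v)" by (simp add: complex_add_cnj)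
  then show "jm k v = complex_of_real (Re z) *s v" by simp
  with 1 have "\<i> *s t k v = (z - complex_of_real (Re z)) *s v"
    by (simp add: scale_left_diff_distrib algebra_simps)
  also have "z - complex_of_real (Re z) = \<i> * complex_of_real (Im z)" by (simp add: complex_eq_iff)
  finally have "(- \<i>) *s (\<i> *s t k v) = (- \<i>) *s ((\<i> * complex_of_real (Im z)) *s v)" by simp
  then show "t k v = complex_of_real (Im z) *s v" by simp
qed

lemma weig_iff:
  assumes "0 < k" "k \<le> n"
  shows "v \<in> weig k z \<longleftrightarrow> jm k v = complex_of_real (Re z) *s v \<and> t k v = complex_of_real (Im z) *s v"
proof
  assume "jm k v = complex_of_real (Re z) *s v \<and> t k v = complex_of_real (Im z) *s v"
  then have "wop k v = (complex_of_real (Re z) + \<i> * complex_of_real (Im z)) *s v"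
    by (simp add: wop_def scale_left_distrib)
  then show "v \<in> weig k z" using complex_eq[of z] by (simp add: eig_def)
qed (use weig_jm_t assms in blast)

lemma weig_Im:
  assumes "0 < k" "k \<le> n" "v \<in> weig k z" "v \<noteq> 0"
  shows "Im z = 1 \<or> Im z = - 1"
proof -
  have "v = (complex_of_real (Im z) * complex_of_real (Im z)) *s v"
    using t_t[OF assms(1,2), of v] weig_jm_t(2)[OF assms(1-3)] lin_simps(2)[OF lin_t[OF assms(1,2)]]
    by simp
  then have "complex_of_real (Im z) * complex_of_real (Im z) = 1"
    using assms(4) by (metis scale_cancel_right scale_one)
  then have "Im z * Im z = 1" by (metis of_real_eq_1_iff of_real_mult)
  then show ?thesis by (simp add: square_eq_1_iff)
qed

text \<open>The Hecke relations decide how \<open>s k\<close> acts on the span of \<open>v\<close>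
  and \<open>s k v\<close>. For different signs the correction term vanishes and \<open>s k\<close>
  exchanges the eigenvalues. For equal signs, subtracting \<open>v / (b - a)\<close> from
  \<open>s k v\<close> leaves a vector with exchanged eigenvalues.\<close>

lemma s_weig:
  assumes k: "0 < k" "k < n" and v: "v \<in> weig k a" "v \<in> weig (Suc k) b" "v \<noteq> 0"
  shows "a \<noteq> b"
    and "\<exists>c u. s k v = c *s v + u \<and> u \<in> weig k b \<and> u \<in> weig (Suc k) a \<and> (u = 0 \<longleftrightarrow> b - a \<in> {1, - 1})"
    and "b - a \<in> {1, - 1} \<Longrightarrow> s k v = (b - a) *s v"
proof -
  have k': "0 < Suc k" "Suc k \<le> n" "k \<le> n" using k by auto
  let ?r = "\<lambda>z. complex_of_real (Re z)" and ?i = "\<lambda>z. complex_of_real (Im z)"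
  have ev: "jm k v = ?r a *s v" "t k v = ?i a *s v" "jm (Suc k) v = ?r b *s v" "t (Suc k) v = ?i b *s v"
    using weig_jm_t[OF k(1) k'(3) v(1)] weig_jm_t[OF k'(1,2) v(2)] by auto
  note ls = lin_simps[OF lin_s[OF k]] and ljm = lin_simps[OF lin_jm[OF k'(3)]] lin_simps[OF lin_jm[OF k'(2)]]
    and lt = lin_simps[OF lin_t[OF k(1) k'(3)]] lin_simps[OF lin_t[OF k'(1,2)]]
  have ts: "t k (s k v) = ?i b *s s k v" "t (Suc k) (s k v) = ?i a *s s k v"
    using s_t[OF k, of v] s_t'[OF k, of v] by (simp_all add: ev ls)
  have ne0: "s k v \<noteq> 0" using s_s[OF k, of v] v(3) ls(3) by metis
  \<comment> \<open>The eigenvalue on \<open>v\<close> of the projection onto equal signs: 1 or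
    0.\<close>
  define m where "m = (1 + ?i a * ?i b) / 2"
  have pi: "(1 / 2) *s (v + t k (t (Suc k) v)) = m *s v"
    by (simp add: ev lt m_def scale_left_distrib scale_right_distrib add_divide_distrib mult.commute)
  have js: "jm (Suc k) (s k v) = ?r a *s s k v + m *s v" "jm k (s k v) = ?r b *s s k v - m *s v"
    using s_jm[OF k, of v] jm_s[OF k, of v] unfolding pi unfolding ev ls by auto
  consider (diff) "Im a \<noteq> Im b" "m = 0" | (same) "Im a = Im b" "m = 1"
    using weig_Im[OF k(1) k'(3) v(1,3)] weig_Im[OF k'(1,2) v(2,3)] by (auto simp: m_def)
  then have "a \<noteq> b \<and>
    (\<exists>c u. s k v = c *s v + u \<and> u \<in> weig k b \<and> u \<in> weig (Suc k) a \<and> (u = 0 \<longleftrightarrow> b - a \<in> {1, - 1})) \<and>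
    (b - a \<in> {1, - 1} \<longrightarrow> s k v = (b - a) *s v)"
  proof cases
    case diff
    have "b - a \<notin> {1, - 1}" using diff by (auto simp: complex_eq_iff)
    moreover have "s k v \<in> weig k b" "s k v \<in> weig (Suc k) a"
      unfolding weig_iff[OF k(1) k'(3)] weig_iff[OF k'(1,2)] using js ts diff by auto
    ultimately show ?thesis using diff ne0
      by (intro conjI exI[of _ 0] exI[of _ "s k v"]) auto
  next
    case same
    have ab: "b - a = ?r b - ?r a" using same by (simp add: complex_eq_iff)
    have ne: "a \<noteq> b"
    proof
      assume "a = b"
      have l: "lin (wop (Suc k))" using normal_wop[OF k'(1,2)] normal_op_linear by blast
      \<comment> \<open>If \<open>a = b\<close>, then \<open>wop (Suc k) - b\<close> would map
        \<open>s k v\<close> to \<open>v\<close> and \<open>v\<close> to 0, which is a Jordan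
        block.\<close>
      have w: "wop (Suc k) (s k v) - b *s s k v = v"
      proof -
        have "wop (Suc k) (s k v) = (?r a + \<i> * ?i a) *s s k v + v"
          by (simp add: wop_def js ts same scale_left_distrib del: jm.simps)
        then show ?thesis using complex_eq[of a] \<open>a = b\<close> by simp
      qed
      moreover have "wop (Suc k) v - b *s v = 0" using v(2) by (simp add: eig_def)
      ultimately have "v = 0"
        using normal_op_kernel_square[OF normal_op_shift[OF normal_wop[OF k'(1,2)], of b], where v = "s k v"] by simp
      with v show False by simp
    qed
    define d where "d = b - a"
    have d: "d \<noteq> 0" "?r b = ?r a + d" using ne ab by (auto simp: d_def)
    define u where "u = s k v - (1 / d) *s v"
    have sv: "s k v = (1 / d) *s v + u" by (simp add: u_def)
    have uk: "u \<in> weig k b" "u \<in> weig (Suc k) a"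
    proof -
      have e: "?r b / d = 1 + ?r a / d" using d by (simp add: field_simps)
      have "jm k u = ?r b *s u" unfolding u_def ljm js ev same
        by (simp add: scale_right_diff_distrib e scale_left_distrib diff_diff_eq)
      moreover have "jm (Suc k) u = ?r a *s u" unfolding u_def ljm js ev same
        by (simp add: scale_right_diff_distrib e scale_left_distrib)
      moreover have "t k u = ?i b *s u" "t (Suc k) u = ?i a *s u"
        unfolding u_def lt ts ev using same by (simp_all add: scale_right_diff_distrib scale_left_commute)
      ultimately show "u \<in> weig k b" "u \<in> weig (Suc k) a"
        unfolding weig_iff[OF k(1) k'(3)] weig_iff[OF k'(1,2)] by auto
    qed
    have u0: "u = 0 \<longleftrightarrow> d \<in> {1, - 1}"
    proof
      assume "u = 0"
      then have "v = (1 / d) *s (1 / d) *s v" using s_s[OF k, of v] sv ls by (metis add.right_neutral)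
      then have "(1 / d) * (1 / d) = 1" using v(3) by (metis scale_cancel_right scale_one scale_scale)
      then have "d * d = 1" using d by (simp add: field_simps)
      then show "d \<in> {1, - 1}" by (simp add: square_eq_1_iff)
    next
      assume d1: "d \<in> {1, - 1}"
      then have dd: "1 / d = d" "d * d = 1" "cnj d = d" by auto
      \<comment> \<open>\<open>u\<close> and \<open>v\<close> have the different eigenvalues
        \<open>b\<close> and \<open>a\<close> under \<open>wop k\<close>. Since
        \<open>s k u = - d u\<close> and \<open>s k\<close> is self-adjoint, \<open>u\<close> is
        then orthogonal to \<open>s k v\<close> as well, and so to itself.\<close>
      have "ip u v = 0" by (rule eig_orthogonal[OF normal_wop[OF k(1) k'(3)] uk(1) v(1)]) (use ne in auto)
      moreover have "s k u = - (d *s u)"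
        unfolding u_def ls s_s[OF k] dd(1) by (simp add: scale_right_diff_distrib dd(2))
      moreover have "ip u u = ip u (s k v) - cnj d * ip u v"
        using ip_diff_right[of u "s k v" "d *s v"] dd by (simp add: u_def ip_scale_right)
      moreover have "ip u (s k v) = ip (s k u) v" using s_selfadjoint[OF k] by simp
      ultimately have "ip u u = 0" by (simp add: ip_minus_left ip_scale_left)
      then show "u = 0" by (rule ip_anisotropic)
    qed
    then have "d \<in> {1, - 1} \<longrightarrow> s k v = d *s v" using sv by auto
    with ne sv uk u0 show ?thesis unfolding d_def by blast
  qed
  then show "a \<noteq> b"
    and "\<exists>c u. s k v = c *s v + u \<and> u \<in> weig k b \<and> u \<in> weig (Suc k) a \<and> (u = 0 \<longleftrightarrow> b - a \<in> {1, - 1})"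
    and "b - a \<in> {1, - 1} \<Longrightarrow> s k v = (b - a) *s v" by blast+
qed

end

context hermitian_space
begin

lemma eig_commute: "lin c \<Longrightarrow> (\<And>v. c (N v) = N (c v)) \<Longrightarrow> v \<in> eig N z \<Longrightarrow> c v \<in> eig N z"
  unfolding eig_def mem_Collect_eq by (metis lin_simps(2))

lemma other_eigs_commute:
  "lin c \<Longrightarrow> (\<And>v. c (N v) = N (c v)) \<Longrightarrow> v \<in> other_eigs N z \<Longrightarrow> c v \<in> other_eigs N z"
  unfolding other_eigs_def by (rule span_invariant) (auto intro!: span_base eig_commute)

end

context hyperoctahedral_tower
begin

section \<open>Submodules and eigenspaces of the last operator\<close>

definition submod :: "nat \<Rightarrow> 'v set \<Rightarrow> bool" where
  "submod k W \<longleftrightarrow> subspace W \<and> (\<forall>g\<in>G k. \<forall>w\<in>W. g w \<in> W)"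

definition irr :: "nat \<Rightarrow> 'v set \<Rightarrow> bool" where
  "irr k U \<longleftrightarrow> submod k U \<and> U \<noteq> {0} \<and> (\<forall>W. submod k W \<and> W \<subseteq> U \<longrightarrow> W = {0} \<or> W = U)"

lemma submod_Int: "submod k U \<Longrightarrow> submod k W \<Longrightarrow> submod k (U \<inter> W)"
  by (auto simp: submod_def intro: subspace_inter)

lemma submod_mono: "submod k U \<Longrightarrow> j \<le> k \<Longrightarrow> k \<le> n \<Longrightarrow> submod j U"
  using G_mono unfolding submod_def by blast

lemma wop_commute:
  assumes "k < n" "g \<in> G k"
  shows "g (wop (Suc k) v) = wop (Suc k) (g v)"
proof -
  have "lin g" using G_linear[of k g] assms by simp
  then show ?thesis
    using jm_commute_Suc[OF assms(1)] t_comm[OF assms] assms(2) by (simp add: wop_def lin_simps)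
qed

lemma submod_weig:
  assumes "k < n"
  shows "submod k (weig (Suc k) z)" "submod k (other_eigs (wop (Suc k)) z)"
  using assms G_linear[of k] wop_commute[OF assms] normal_op_linear[OF normal_wop[of "Suc k"]]
  unfolding submod_def
  by (auto intro: subspace_eig subspace_other_eigs eig_commute other_eigs_commute)

lemma submod_jm:
  assumes "submod k W" "k \<le> n"
  shows "j \<le> k \<Longrightarrow> w \<in> W \<Longrightarrow> jm j w \<in> W"
proof (induction j arbitrary: w)
  case 0
  then show ?case using assms by (simp add: submod_def subspace_0)
next
  case (Suc j)
  have W: "subspace W" "\<And>g w. g \<in> G k \<Longrightarrow> w \<in> W \<Longrightarrow> g w \<in> W" using assms by (auto simp: submod_def)
  show ?case
  proof (cases "j = 0")
    case False
    then have "s j \<in> G k" "t j \<in> G k" "t (Suc j) \<in> G k" using Suc.prems assms s_in_G' t_in_G' by auto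
    then show ?thesis using False Suc W by (auto simp: jm.simps(2) intro!: subspace_add subspace_scale)
  qed (use W in \<open>simp add: jm.simps(2) subspace_0\<close>)
qed

lemma submod_wop:
  assumes "submod k W" "k \<le> n" "0 < j" "j \<le> k" "w \<in> W"
  shows "wop j w \<in> W"
  using submod_jm[OF assms(1,2,4,5)] t_in_G'[OF assms(3,4,2)] assms(1,5)
  by (auto simp: wop_def submod_def intro: subspace_add subspace_scale)

text \<open>
  By lemma \<open>s_weig\<close>, \<open>s k\<close> moves a submodule
  \<open>W\<close> of an eigenspace of \<open>wop (Suc k)\<close> into \<open>W\<close> plus the other eigenspaces. By the double coset
  decomposition the \<open>G (Suc k)\<close>-module generated by \<open>W\<close> therefore meets the eigenspace in \<open>W\<close> only.
\<close>

theorem irr_weig: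
  assumes k: "k < n" and U: "irr (Suc k) U" and ne: "U \<inter> weig (Suc k) d \<noteq> {0}"
  shows "irr k (U \<inter> weig (Suc k) d)"
proof -
  let ?E = "weig (Suc k) d" and ?F = "other_eigs (wop (Suc k)) d"
  have kn: "Suc k \<le> n" "k \<le> n" using k by auto
  have subU: "submod (Suc k) U" using U by (simp add: irr_def)
  have "W = U \<inter> ?E" if W: "submod k W" "W \<subseteq> U \<inter> ?E" "W \<noteq> {0}" for W
  proof -
    have sW: "subspace W" using W by (simp add: submod_def)
    have sF: "subspace ?F" by (rule subspace_other_eigs)
    define K where "K = {w + r | w r. w \<in> W \<and> r \<in> ?F}"
    have sK: "subspace K" unfolding K_def using subspace_sums[OF sW sF] .
    have WK: "W \<subseteq> K" unfolding K_def using subspace_0[OF sF] by force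
    have FK: "?F \<subseteq> K" unfolding K_def using subspace_0[OF sW] by force
    have gK: "g x \<in> K" if "g \<in> G k" "x \<in> K" for g x
      using that W(1) submod_weig(2)[OF k, of d] lin_simps(1)[OF G_linear[OF kn(2) that(1)]]
      unfolding K_def submod_def by blast
    have tK: "t (Suc k) x \<in> K" if x: "x \<in> K" for x
    proof -
      obtain w r where w: "x = w + r" "w \<in> W" "r \<in> ?F" using x by (auto simp: K_def)
      have lt: "lin (t (Suc k))" using lin_t kn by simp
      have "t (Suc k) w \<in> W"
        using weig_jm_t(2)[of "Suc k" w d] w(2) W(2) kn by (auto intro!: subspace_scale sW)
      moreover have "t (Suc k) r \<in> ?F"
        by (rule other_eigs_commute[OF lt _ w(3)])
          (use jm_commute_Suc[OF k] in \<open>simp add: wop_def lin_simps[OF lt]\<close>)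
      ultimately show ?thesis using w(1) lin_simps(1)[OF lt] by (auto simp: K_def)
    qed
    have sK': "s k w \<in> K" if k0: "0 < k" and w: "w \<in> W" for w
    proof -
      have ls: "lin (s k)" using lin_s k0 k by simp
      \<comment> \<open>\<open>s_weig\<close> speaks of joint eigenvectors, so \<open>W\<close>,
        already inside one eigenspace of \<open>wop (Suc k)\<close> and stable under
        \<open>wop k\<close>, is split into eigenspaces of \<open>wop k\<close>.\<close>
      have wspan: "w \<in> span (\<Union>z. W \<inter> weig k z)"
        by (rule normal_op_span[OF normal_wop sW]) (use k0 kn submod_wop[OF W(1) kn(2) k0] w in auto)
      have "s k w \<in> span K"
      proof (rule span_invariant[OF ls _ wspan])
        fix x assume "x \<in> (\<Union>z. W \<inter> weig k z)"
        then obtain e where x: "x \<in> W" "x \<in> weig k e" by blast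
        show "s k x \<in> span K"
        proof (cases "x = 0")
          case True
          then show ?thesis using lin_simps(3)[OF ls] by (simp add: span_zero)
        next
          case False
          have xd: "x \<in> ?E" using x W(2) by blast
          obtain c u where u: "s k x = c *s x + u" "u \<in> weig (Suc k) e"
            using s_weig(2)[OF k0 k x(2) xd False] by blast
          have "e \<noteq> d" using s_weig(1)[OF k0 k x(2) xd False] .
          then have "u \<in> ?F" unfolding other_eigs_def using u(2) by (auto intro: span_base)
          then have "c *s x + u \<in> K"
            using x(1) WK FK by (intro subspace_add[OF sK] subspace_scale[OF sK]) auto
          then show ?thesis using u(1) by (simp add: span_base)
        qed
      qed
      then show ?thesis using sK by (metis span_eq_iff)
    qed
    have GW: "g w \<in> K" if g: "g \<in> G (Suc k)" and w: "w \<in> W" for g w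
    proof -
      obtain h h' where h: "h \<in> G k" "h' \<in> G k" and
        dec: "g = h \<or> g = t (Suc k) \<circ> h \<or> 0 < k \<and> (g = h \<circ> s k \<circ> h' \<or> g = t (Suc k) \<circ> (h \<circ> s k \<circ> h'))"
        using G_decompose[OF k g] by blast
      have "h w \<in> K" "0 < k \<Longrightarrow> h (s k (h' w)) \<in> K"
        using gK[OF h(1)] WK w sK' h(2) W(1) by (auto simp: submod_def)
      then show ?thesis using dec tK by auto
    qed
    define M where "M = span {g w | g w. g \<in> G (Suc k) \<and> w \<in> W}"
    have "submod (Suc k) M"
      unfolding submod_def
    proof (intro conjI ballI)
      fix g x assume g: "g \<in> G (Suc k)" and x: "x \<in> M"
      show "g x \<in> M" unfolding M_def
      proof (rule span_invariant[OF G_linear[OF kn(1) g] _ x[unfolded M_def]])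
        fix y assume "y \<in> {g w | g w. g \<in> G (Suc k) \<and> w \<in> W}"
        then obtain h w where h: "y = h w" "h \<in> G (Suc k)" "w \<in> W" by blast
        have "g \<circ> h \<in> G (Suc k)" using G_comp[OF kn(1) g h(2)] .
        moreover have "g y = (g \<circ> h) w" using h(1) by simp
        ultimately have "g y \<in> {g w | g w. g \<in> G (Suc k) \<and> w \<in> W}" using h(3) by blast
        then show "g y \<in> span {g w | g w. g \<in> G (Suc k) \<and> w \<in> W}" by (rule span_base)
      qed
    qed (simp add: M_def)
    moreover have "M \<subseteq> U" unfolding M_def
      by (rule span_minimal) (use subU W(2) in \<open>auto simp: submod_def\<close>)
    moreover have "w \<in> M" if "w \<in> W" for w
      unfolding M_def by (rule span_base) (use id_in_G[OF kn(1)] that in \<open>auto intro!: exI[of _ id]\<close>)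
    then have "M \<noteq> {0}" using W(3) subspace_0[OF sW] by blast
    ultimately have "M = U" using U unfolding irr_def by blast
    moreover have "M \<subseteq> K" unfolding M_def by (rule span_minimal[OF _ sK]) (use GW in auto)
    ultimately have UK: "U \<subseteq> K" by simp
    have "U \<inter> ?E \<subseteq> W"
    proof
      fix u assume u: "u \<in> U \<inter> ?E"
      then obtain w r where w: "u = w + r" "w \<in> W" "r \<in> ?F" using UK by (auto simp: K_def)
      then have "r = u - w" by simp
      then have "r \<in> ?E" using u w(2) W(2) normal_op_linear[OF normal_wop[of "Suc k"]] kn
        by (auto intro!: subspace_diff subspace_eig)
      then have "r = 0" using eig_Int_other_eigs[OF normal_wop _ w(3)] kn by simp
      then show "u \<in> W" using w by simp
    qed
    then show ?thesis using W(2) by blast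
  qed
  moreover have "submod k (U \<inter> ?E)"
    using submod_Int submod_weig(1)[OF k] submod_mono[OF subU] kn by simp
  ultimately show ?thesis using ne unfolding irr_def by blast
qed

section \<open>Weights of a submodule\<close>

primrec wspace :: "complex list \<Rightarrow> 'v set" where
  "wspace [] = UNIV"
| "wspace (z # zs) = weig (Suc (length zs)) z \<inter> wspace zs"

definition weight :: "'v set \<Rightarrow> complex list \<Rightarrow> bool" where
  "weight U zs \<longleftrightarrow> (\<exists>u\<in>U. u \<noteq> 0 \<and> u \<in> wspace zs)"

text \<open>The head of a weight belongs to the highest level, just as the head of a
  \<open>slide_path\<close> removes the last box; peeling it off passes to an eigenspace of the last
  operator.\<close>

lemma weight_Cons: "weight U (z # zs) \<longleftrightarrow> weight (U \<inter> weig (Suc (length zs)) z) zs"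
  by (auto simp: weight_def)

lemma subspace_wspace: "length zs \<le> n \<Longrightarrow> subspace (wspace zs)"
  by (induction zs) (auto intro!: subspace_inter subspace_eig normal_op_linear normal_wop)

lemma wspace_commute:
  assumes "lin c" "\<And>j v. 0 < j \<Longrightarrow> j \<le> length zs \<Longrightarrow> c (wop j v) = wop j (c v)" "v \<in> wspace zs"
  shows "c v \<in> wspace zs"
  using assms(2,3) by (induction zs) (auto intro: eig_commute[OF assms(1)])

lemma s_wop:
  assumes "Suc i < n" "0 < j" "j \<le> i"
  shows "s (Suc i) (wop j v) = wop j (s (Suc i) v)"
proof -
  have l: "lin (s (Suc i))" using lin_s assms by simp
  have "s (Suc i) (jm j v) = jm j (s (Suc i) v)"
    by (rule jm_commute_G[of i]) (use assms l s_comm in auto)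
  moreover have "s (Suc i) (t j v) = t j (s (Suc i) v)"
    using s_comm[OF assms(1) t_in_G'[of j i]] assms by simp
  ultimately show ?thesis by (simp add: wop_def lin_simps[OF l])
qed

text \<open>The new weight vector is the component \<open>u\<close> of \<open>s (Suc i) v\<close>
  given by \<open>s_weig\<close>. Its lower entries are unchanged because the operators below
  commute with \<open>s (Suc i)\<close>.\<close>

lemma weight_swap:
  assumes "submod (Suc (Suc i)) U" "Suc (Suc i) \<le> n" "length zs = i" "weight U (b # a # zs)"
  shows "a \<noteq> b" "b - a \<notin> {1, - 1} \<Longrightarrow> weight U (a # b # zs)"
proof -
  obtain v where v: "v \<in> U" "v \<noteq> 0" "v \<in> weig (Suc (Suc i)) b" "v \<in> weig (Suc i) a" "v \<in> wspace zs"
    using assms(3,4) by (auto simp: weight_def)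
  have k: "0 < Suc i" "Suc i < n" using assms by auto
  show "a \<noteq> b" using s_weig(1)[OF k v(4,3,2)] .
  assume ba: "b - a \<notin> {1, - 1}"
  then obtain c u where u: "s (Suc i) v = c *s v + u" "u \<in> weig (Suc i) b" "u \<in> weig (Suc (Suc i)) a" "u \<noteq> 0"
    using s_weig(2)[OF k v(4,3,2)] by blast
  have eq: "u = s (Suc i) v - c *s v" using u(1) by simp
  have "s (Suc i) v \<in> wspace zs"
    by (rule wspace_commute[OF lin_s[OF k] _ v(5)]) (use s_wop k assms(3) in auto)
  then have "u \<in> wspace zs" unfolding eq
    using subspace_wspace[of zs] v(5) assms by (intro subspace_diff subspace_scale) auto
  moreover have "u \<in> U" unfolding eq
    using assms(1) v(1) s_in_G[OF k] by (auto simp: submod_def intro!: subspace_diff subspace_scale)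
  ultimately show "weight U (a # b # zs)" using u assms(3) by (auto simp: weight_def)
qed

text \<open>On such a vector the two neighbouring transpositions would act by the scalars
  \<open>- d\<close> and \<open>d\<close>, and the braid relation would equate
  \<open>d * d * d\<close> with its negative.\<close>

lemma not_weight_braid:
  assumes "Suc (Suc (Suc (length zs))) \<le> n" "b - a \<in> {1, - 1}"
  shows "\<not> weight U (b # a # b # zs)"
proof
  let ?i = "length zs"
  assume "weight U (b # a # b # zs)"
  then obtain v where v: "v \<noteq> 0" "v \<in> weig (Suc (Suc (Suc ?i))) b" "v \<in> weig (Suc (Suc ?i)) a" "v \<in> weig (Suc ?i) b"
    by (auto simp: weight_def)
  have k: "0 < Suc ?i" "Suc ?i < n" "0 < Suc (Suc ?i)" "Suc (Suc ?i) < n" using assms by auto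
  define d where "d = b - a"
  have "a - b \<in> {1, - 1}" using assms(2) by (auto simp: algebra_simps)
  then have s1: "s (Suc ?i) v = (- d) *s v" using s_weig(3)[OF k(1,2) v(4,3,1)] by (simp add: d_def)
  have s2: "s (Suc (Suc ?i)) v = d *s v"
    using s_weig(3)[OF k(3,4) v(3,2,1) assms(2)] by (simp add: d_def)
  have "(d * d * d) *s v = (- (d * d * d)) *s v"
    using braid[OF k(1,4), of v]
    by (simp add: s1 s2 lin_simps[OF lin_s[OF k(1,2)]] lin_simps[OF lin_s[OF k(3,4)]] mult.assoc)
  then have "d * d * d = - (d * d * d)" using v(1) by (metis scale_cancel_right)
  then show False using assms(2) by (auto simp: d_def)
qed

text \<open>The paths, not only their number, are needed to compare the diagrams of different
  eigenspaces. The last conjunct provides a path from which \<open>Y\<close> can be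
  recovered.\<close>

definition irr_shape :: "nat \<Rightarrow> 'v set \<Rightarrow> int set \<Rightarrow> bool" where
  "irr_shape k U Y \<longleftrightarrow>
     (\<forall>zs. length zs = k \<longrightarrow> (weight U zs \<longleftrightarrow> (\<exists>ps. zs = map label ps \<and> slide_path ps Y))) \<and>
     dim U = path_count k Y \<and> (\<exists>ps. slide_path ps Y \<and> length ps = k)"

lemma weight_iff_label:
  assumes "irr_shape k U Y" "length ps = k"
  shows "weight U (map label ps) \<longleftrightarrow> slide_path ps Y"
proof -
  have "map label ps = map label qs \<longleftrightarrow> ps = qs" for qs
    using inj_label by (simp add: inj_map_eq_map)
  then show ?thesis using assms by (auto simp: irr_shape_def)
qed

lemma irr_shape_0:
  assumes "irr 0 U"
  shows "irr_shape 0 U vacuum"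
proof -
  obtain u where u: "u \<in> U" "u \<noteq> 0"
    using assms subspace_0 by (force simp: irr_def submod_def)
  have "submod 0 (span {u})" by (simp add: submod_def G_0)
  moreover have "span {u} \<subseteq> U" using assms u by (intro span_minimal) (auto simp: irr_def submod_def)
  moreover have "span {u} \<noteq> {0}" using u span_base[of u "{u}"] by blast
  ultimately have "U = span {u}" using assms unfolding irr_def by blast
  then have "dim U = 1" using u by simp
  then show ?thesis using u by (auto simp: irr_shape_def weight_def)
qed

lemma weight_exists:
  "submod k U \<Longrightarrow> k \<le> n \<Longrightarrow> U \<noteq> {0} \<Longrightarrow> \<exists>zs. length zs = k \<and> weight U zs"
proof (induction k arbitrary: U)
  case 0
  then show ?case using subspace_0 by (force simp: submod_def weight_def)
next
  case (Suc k)
  have sU: "subspace U" using Suc.prems by (simp add: submod_def)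
  have "\<exists>z. U \<inter> weig (Suc k) z \<noteq> {0}"
  proof (rule ccontr)
    assume "\<not> ?thesis"
    then have "(\<Union>z. U \<inter> weig (Suc k) z) \<subseteq> {0}" by blast
    then have "span (\<Union>z. U \<inter> weig (Suc k) z) \<subseteq> {0}" using span_minimal subspace_single_0 by blast
    then have "U \<subseteq> {0}" using normal_op_span[OF normal_wop sU submod_wop[OF Suc.prems(1,2)]] Suc.prems(2) by blast
    then show False using Suc.prems(3) subspace_0[OF sU] by blast
  qed
  then obtain z where z: "U \<inter> weig (Suc k) z \<noteq> {0}" by blast
  have "submod k (U \<inter> weig (Suc k) z)"
    using Suc.prems submod_mono[of "Suc k" U k] by (intro submod_Int submod_weig) auto
  with Suc.IH z Suc.prems obtain zs where "length zs = k" "weight (U \<inter> weig (Suc k) z) zs" by auto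
  then show ?case by (intro exI[of _ "z # zs"]) (simp add: weight_Cons)
qed

text \<open>Each eigenspace \<open>E z\<close> has a diagram \<open>Yf z\<close>. Swapping the top
  two entries of a weight relates the diagrams of two eigenspaces, and the forbidden pattern of
  \<open>not_weight_braid\<close> makes \<open>z\<close> the label of an addable box of
  \<open>Yf z\<close>. Adding it gives one and the same diagram for all \<open>z\<close>: the
  eigenspaces with a fixed result span a submodule.\<close>

lemma irr_shape_Suc:
  assumes k: "k < n" and U: "irr (Suc k) U"
    and IH: "\<And>U. irr k U \<Longrightarrow> \<exists>Y. irr_shape k U Y"
  shows "\<exists>Y. irr_shape (Suc k) U Y"
proof -
  have kn: "Suc k \<le> n" "k \<le> n" using k by auto
  have subU: "submod (Suc k) U" using U by (simp add: irr_def)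
  then have sU: "subspace U" by (simp add: submod_def)
  define E where "E = (\<lambda>z. U \<inter> weig (Suc k) z)"
  define D where "D = {z. E z \<noteq> {0}}"
  have "\<forall>z\<in>D. \<exists>Y. irr_shape k (E z) Y"
    using IH irr_weig[OF k U] by (auto simp: D_def E_def)
  then obtain Yf where Yf: "\<And>z. z \<in> D \<Longrightarrow> irr_shape k (E z) (Yf z)" by metis
  have subE: "submod k (E z)" for z
    unfolding E_def using submod_Int submod_weig(1)[OF k] submod_mono[OF subU] kn by simp
  have sE: "subspace (E z)" for z using subE by (simp add: submod_def)
  have ED: "z \<in> D \<longleftrightarrow> (\<exists>u. u \<in> E z \<and> u \<noteq> 0)" for z
    using subspace_0[OF sE[of z]] by (auto simp: D_def)
  have wD: "weight U (z # zs) \<longleftrightarrow> z \<in> D \<and> (\<exists>ps. zs = map label ps \<and> slide_path ps (Yf z))"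
    if "length zs = k" for z zs
  proof -
    have "weight U (z # zs) \<longleftrightarrow> weight (E z) zs" using that by (simp add: weight_Cons E_def)
    moreover have "weight (E z) zs \<Longrightarrow> z \<in> D" using ED by (auto simp: weight_def)
    ultimately show ?thesis using Yf[of z] that by (auto simp: irr_shape_def)
  qed
  have wD': "weight U (z # map label ps) \<longleftrightarrow> z \<in> D \<and> slide_path ps (Yf z)"
    if "length ps = k" for z ps
    using wD[of "map label ps" z] that inj_map_eq_map[OF inj_label] by auto
  have pl: "\<exists>ps. slide_path ps (Yf z) \<and> length ps = k" if "z \<in> D" for z
    using Yf[OF that] by (simp add: irr_shape_def)
  \<comment> \<open>A weight starting with \<open>z\<close>, \<open>label p\<close> is swapped. The
    diagram for \<open>label p\<close> thus arises from \<open>Yf z\<close> by removing the box at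
    \<open>p\<close> and adding one at \<open>q\<close>.\<close>
  have move: "label p \<in> D \<and> (\<exists>q. z = label q \<and> q \<noteq> p \<and> q \<in> movable 2 (Yf (label p)) \<and>
      slide 2 q (Yf (label p)) = slide 2 p (Yf z))"
    if z: "z \<in> D" and p: "p \<in> movable 2 (Yf z)" and na: "z - label p \<notin> {1, - 1}" for z p
  proof -
    obtain ps where "slide_path ps (Yf z)" "length ps = k" using pl z by blast
    then obtain qs where qs: "slide_path (p # qs) (Yf z)" "Suc (length qs) = k"
      using slide_path_last p by blast
    then have w: "weight U (z # label p # map label qs)" using wD'[of "p # qs"] z by simp
    have sub: "submod (Suc (Suc (length qs))) U" "Suc (Suc (length qs)) \<le> n"
      using qs(2) subU kn by auto
    have w2: "weight U (label p # z # map label qs)" and "label p \<noteq> z"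
      using weight_swap[OF sub length_map w] na by blast+
    have "length (z # map label qs) = k" using qs by simp
    from iffD1[OF wD[OF this] w2] obtain ps' where D: "label p \<in> D"
      and ps': "z # map label qs = map label ps'" "slide_path ps' (Yf (label p))"
      by (elim conjE exE)
    then obtain q qs' where "ps' = q # qs'" "z = label q" "map label qs = map label qs'"
      by (cases ps') auto
    then have q: "ps' = q # qs" "z = label q" using inj_map_eq_map[OF inj_label] by auto
    then have "slide 2 q (Yf (label p)) = slide 2 p (Yf z)"
      using ps'(2) qs(1) by (intro slide_path_unique[of qs]) auto
    then show ?thesis using D q ps'(2) \<open>label p \<noteq> z\<close> by auto
  qed
  have addable: "\<exists>q. z = label q \<and> q \<notin> Yf z \<and> q - 2 \<in> Yf z" if z: "z \<in> D" for z
  proof (cases "k = 0")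
    case True
    then have Y: "Yf z = vacuum" using pl[OF z] by auto
    obtain u where u: "u \<in> weig 1 z" "u \<noteq> 0" using z True by (auto simp: ED E_def)
    have n1: "1 \<le> n" using k by simp
    have "complex_of_real (Re z) *s u = 0"
      using weig_jm_t(1)[OF _ n1 u(1)] by (simp add: jm.simps(2))
    then have "Re z = 0" using u by simp
    moreover have "Im z = 1 \<or> Im z = - 1" using weig_Im[OF _ n1 u] by simp
    ultimately have "z = label 0 \<or> z = label 1" by (auto simp: label_def complex_eq_iff)
    then show ?thesis by (auto simp: Y vacuum_def)
  next
    case False
    then obtain p qs where pq: "slide_path (p # qs) (Yf z)" "Suc (length qs) = k"
      using pl[OF z] by (metis Suc_length_conv not0_implies_Suc)
    then have p: "p \<in> movable 2 (Yf z)" by simp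
    then have pY: "p \<in> Yf z" "p - 2 \<notin> Yf z" by (auto simp: movable_def)
    show ?thesis
    proof (cases "z - label p \<in> {1, - 1}")
      case na: False
      then obtain q where q: "z = label q" "q \<noteq> p"
        "slide 2 q (Yf (label p)) = slide 2 p (Yf z)" using move[OF z p] by blast
      have "q \<notin> slide 2 q (Yf (label p))" "q - 2 \<in> slide 2 q (Yf (label p))"
        by (simp_all add: slide_def)
      then have "q \<notin> Yf z" "q - 2 \<in> Yf z" unfolding q(3) using q(2) by (auto simp: slide_def)
      then show ?thesis using q by blast
    next
      case ad: True
      \<comment> \<open>If the box labelled \<open>z\<close> were not addable although
        \<open>z\<close> is adjacent to \<open>label p\<close>, it could be removed right after the
        one at \<open>p\<close>; the weight would begin with \<open>z\<close>,
        \<open>label p\<close>, \<open>z\<close>.\<close>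
      have no: False if "z = label q" "q \<in> movable 2 (slide 2 p (Yf z))" for q
      proof -
        have "slide_path qs (slide 2 p (Yf z))" using pq by simp
        from slide_path_last[OF this that(2)] obtain rs
          where rs: "slide_path (q # rs) (slide 2 p (Yf z))" "Suc (length rs) = length qs" by blast
        then have "weight U (z # map label (p # q # rs))" using wD'[of "p # q # rs" z] p pq z by simp
        then show False
          using not_weight_braid[of "map label rs" z "label p" U] that(1) ad rs pq kn by simp
      qed
      have "label (p + 2) = z \<or> label (p - 2) = z"
        unfolding label_add_2 label_diff_2 using ad by (auto simp: algebra_simps)
      then show ?thesis
      proof
        assume q: "label (p + 2) = z"
        have "p + 2 \<notin> Yf z"
        proof
          assume "p + 2 \<in> Yf z"
          then have "p + 2 \<in> movable 2 (slide 2 p (Yf z))" by (simp add: movable_def slide_def)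
          then show False using no q by blast
        qed
        then show ?thesis using q pY by (intro exI[of _ "p + 2"]) auto
      next
        assume q: "label (p - 2) = z"
        have "p - 2 - 2 \<in> Yf z"
        proof (rule ccontr)
          assume "p - 2 - 2 \<notin> Yf z"
          then have "p - 2 \<in> movable 2 (slide 2 p (Yf z))" by (simp add: movable_def slide_def)
          then show False using no q by blast
        qed
        then show ?thesis using q pY by (intro exI[of _ "p - 2"]) auto
      qed
    qed
  qed
  define raise where "raise = (\<lambda>q (Y::int set). insert q (Y - {q - 2}))"
  have raise_slide: "raise q (slide 2 q Y) = Y" if "q \<in> movable 2 Y" for q Y
    using that by (auto simp: raise_def slide_def movable_def)
  have slide_raise: "q \<in> movable 2 (raise q Y) \<and> slide 2 q (raise q Y) = Y" if "q \<notin> Y" "q - 2 \<in> Y" for q Y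
    using that by (auto simp: raise_def slide_def movable_def)
  have "D \<noteq> {}"
  proof -
    obtain zs where "length zs = Suc k" "weight U zs"
      using weight_exists[OF subU kn(1)] U by (auto simp: irr_def)
    then show ?thesis using wD by (cases zs) auto
  qed
  then obtain z0 q0 where z0: "z0 \<in> D" "z0 = label q0" "q0 \<notin> Yf z0" "q0 - 2 \<in> Yf z0"
    using addable by blast
  define Y where "Y = raise q0 (Yf z0)"
  \<comment> \<open>The eigenvalues whose diagrams extend to the same \<open>Y\<close> as that of
    \<open>z0\<close>. Irreducibility will give \<open>D0 = D\<close>.\<close>
  define D0 where "D0 = {z \<in> D. \<exists>q. z = label q \<and> raise q (Yf z) = Y}"
  have D0_move: "label p \<in> D0"
    if z: "z \<in> D0" and p: "p \<in> movable 2 (Yf z)" and na: "z - label p \<notin> {1, - 1}" for z p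
  proof -
    obtain q where q: "z \<in> D" "z = label q" "raise q (Yf z) = Y" using z by (auto simp: D0_def)
    then have m: "label p \<in> D" "q \<in> movable 2 (Yf (label p))" "q \<noteq> p"
      "slide 2 q (Yf (label p)) = slide 2 p (Yf z)" using move[OF _ p na] by auto
    \<comment> \<open>With \<open>p \<noteq> q\<close> this makes the two additions of boxes
      independent of their order.\<close>
    have ne: "p \<noteq> q - 2" "q \<noteq> p - 2" using na label_adjacent_iff[of q p] q(2) by auto
    have "raise p (Yf (label p)) = raise p (raise q (slide 2 p (Yf z)))"
      using raise_slide[OF m(2)] m(4) by simp
    also have "\<dots> = raise q (raise p (slide 2 p (Yf z)))"
      using ne unfolding raise_def by blast
    also have "\<dots> = Y" using raise_slide[OF p] q(3) by simp
    finally show ?thesis using m by (auto simp: D0_def)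
  qed
  define U' where "U' = span (\<Union>z\<in>D0. E z)"
  have gU': "g u \<in> U'" if g: "g \<in> G k" and u: "u \<in> U'" for g u
    unfolding U'_def
  proof (rule span_invariant[OF G_linear[OF kn(2) g] _ u[unfolded U'_def]])
    show "g x \<in> span (\<Union>z\<in>D0. E z)" if "x \<in> (\<Union>z\<in>D0. E z)" for x
      using that subE g by (intro span_base) (auto simp: submod_def)
  qed
  have tU': "t (Suc k) u \<in> U'" if u: "u \<in> U'" for u
    unfolding U'_def
  proof (rule span_invariant[OF _ _ u[unfolded U'_def]])
    show "lin (t (Suc k))" using lin_t kn by simp
    fix x assume x: "x \<in> (\<Union>z\<in>D0. E z)"
    then obtain z where "x \<in> weig (Suc k) z" by (auto simp: E_def)
    then have "t (Suc k) x = complex_of_real (Im z) *s x" using weig_jm_t(2) kn by blast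
    then show "t (Suc k) x \<in> span (\<Union>z\<in>D0. E z)" using x by (simp add: span_scale span_base)
  qed
  have sU': "s k u \<in> U'" if k0: "0 < k" and u: "u \<in> U'" for u
    unfolding U'_def
  proof (rule span_invariant[OF lin_s[OF k0 k] _ u[unfolded U'_def]])
    fix x assume "x \<in> (\<Union>z\<in>D0. E z)"
    then obtain z where z: "z \<in> D0" "x \<in> E z" by blast
    have x: "x \<in> span (\<Union>e. E z \<inter> weig k e)"
      by (rule normal_op_span[OF normal_wop sE]) (use k0 kn submod_wop[OF subE kn(2) k0] z in auto)
    show "s k x \<in> span (\<Union>z\<in>D0. E z)"
    proof (rule span_invariant[OF lin_s[OF k0 k] _ x])
      fix y assume "y \<in> (\<Union>e. E z \<inter> weig k e)"
      then obtain e where y: "y \<in> E z" "y \<in> weig k e" by blast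
      show "s k y \<in> span (\<Union>z\<in>D0. E z)"
      proof (cases "y = 0")
        case True
        then show ?thesis using lin_simps(3)[OF lin_s[OF k0 k]] by (simp add: span_zero)
      next
        case False
        have yz: "y \<in> weig (Suc k) z" "y \<in> U" using y(1) by (auto simp: E_def)
        obtain c v where v: "s k y = c *s y + v" "v \<in> weig (Suc k) e" "v = 0 \<longleftrightarrow> z - e \<in> {1, - 1}"
          using s_weig(2)[OF k0 k y(2) yz(1) False] by blast
        obtain i where i: "k = Suc i" using k0 by (cases k) auto
        have "submod i (E z \<inter> weig k e)"
          using submod_weig(1)[of i e] submod_mono[OF subE, of i] i kn by (intro submod_Int) auto
        moreover have "E z \<inter> weig k e \<noteq> {0}" using y False by blast
        ultimately obtain zs where "length zs = i" "weight (E z \<inter> weig k e) zs"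
          using weight_exists[of i] i kn by auto
        then have we: "weight U (z # e # zs)" and len: "length (e # zs) = k"
          using i by (simp_all add: weight_Cons E_def)
        from iffD1[OF wD[OF len] we] obtain ps where "e # zs = map label ps" "slide_path ps (Yf z)"
          by (elim conjE exE)
        then obtain p where p: "e = label p" "p \<in> movable 2 (Yf z)" by (cases ps) auto
        \<comment> \<open>\<open>s k\<close> leaves \<open>E z\<close> only through a nonzero
          \<open>v\<close>. Then \<open>z\<close> and \<open>e\<close> are not adjacent, and
          \<open>D0_move\<close> places \<open>e\<close> in \<open>D0\<close>.\<close>
        have "v \<in> span (\<Union>z\<in>D0. E z)"
        proof (cases "v = 0")
          case False
          then have "e \<in> D0" using D0_move[OF z(1) p(2)] v(3) p(1) by blast
          moreover have "s k y \<in> U" using subU s_in_G[OF k0 k] yz(2) by (simp add: submod_def)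
          then have "v \<in> U" using v(1) yz(2) sU by (metis add_diff_cancel_left' subspace_diff subspace_scale)
          ultimately show ?thesis using v(2) by (intro span_base) (auto simp: E_def)
        qed (simp add: span_zero)
        then show ?thesis using v(1) y(1) z(1) by (auto intro!: span_add span_scale intro: span_base)
      qed
    qed
  qed
  have "submod (Suc k) U'"
    unfolding submod_def
  proof (intro conjI ballI)
    fix g u assume g: "g \<in> G (Suc k)" and u: "u \<in> U'"
    obtain h h' where h: "h \<in> G k" "h' \<in> G k" and
      dec: "g = h \<or> g = t (Suc k) \<circ> h \<or> 0 < k \<and> (g = h \<circ> s k \<circ> h' \<or> g = t (Suc k) \<circ> (h \<circ> s k \<circ> h'))"
      using G_decompose[OF k g] by blast
    have "h u \<in> U'" "0 < k \<Longrightarrow> h (s k (h' u)) \<in> U'" using gU' h u sU' by auto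
    then show "g u \<in> U'" using dec tU' by auto
  qed (simp add: U'_def)
  moreover have "U' \<subseteq> U" unfolding U'_def by (rule span_minimal[OF _ sU]) (auto simp: E_def)
  moreover have "z0 \<in> D0" using z0 by (auto simp: D0_def Y_def)
  then have "E z0 \<subseteq> U'" unfolding U'_def by (auto intro: span_base)
  then have "U' \<noteq> {0}" using z0(1) ED by auto
  ultimately have U'U: "U' = U" using U unfolding irr_def by blast
  have DD0: "z \<in> D0" if z: "z \<in> D" for z
  proof (rule ccontr)
    assume "z \<notin> D0"
    then have "U' \<subseteq> other_eigs (wop (Suc k)) z"
      unfolding U'_def other_eigs_def by (intro span_mono) (auto simp: E_def)
    moreover obtain u where "u \<in> E z" "u \<noteq> 0" using z ED by blast
    ultimately show False using eig_Int_other_eigs[OF normal_wop[of "Suc k"]] kn U'U by (auto simp: E_def)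
  qed
  have D1: "\<exists>q. z = label q \<and> q \<in> movable 2 Y \<and> slide 2 q Y = Yf z" if z: "z \<in> D" for z
  proof -
    obtain q where "z = label q" "raise q (Yf z) = Y" using DD0[OF z] by (auto simp: D0_def)
    moreover obtain q' where "z = label q'" "q' \<notin> Yf z" "q' - 2 \<in> Yf z" using addable[OF z] by blast
    ultimately show ?thesis using slide_raise[of q "Yf z"] by auto
  qed
  have D2: "label p \<in> D" if p: "p \<in> movable 2 Y" for p
  proof (cases "p = q0")
    case False
    have pp: "p \<in> Y" "p - 2 \<notin> Y" using p by (auto simp: movable_def)
    \<comment> \<open>In \<open>Y\<close> the place \<open>q0\<close> is occupied and
      \<open>q0 - 2\<close> is empty, so a movable bead other than \<open>q0\<close> is not adjacent
      to it and is movable in \<open>Yf z0\<close> already.\<close>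
    then have "p \<in> Yf z0" "p - 2 \<notin> Yf z0" "p \<noteq> q0 + 2" "p \<noteq> q0 - 2"
      using False by (auto simp: Y_def raise_def)
    then have "p \<in> movable 2 (Yf z0)" "z0 - label p \<notin> {1, - 1}"
      using label_adjacent_iff[of q0 p] z0(2) by (auto simp: movable_def)
    then show ?thesis using D0_move[OF \<open>z0 \<in> D0\<close>] by (simp add: D0_def)
  qed (use z0 in simp)
  have Deq: "D = label ` movable 2 Y" using D1 D2 by auto
  have Yfp: "Yf (label p) = slide 2 p Y" if "p \<in> movable 2 Y" for p
    using D1[OF D2[OF that]] by auto
  have "irr_shape (Suc k) U Y"
    unfolding irr_shape_def
  proof (intro conjI allI impI)
    fix zs :: "complex list" assume "length zs = Suc k"
    then obtain z zs' where zs: "zs = z # zs'" "length zs' = k" by (cases zs) auto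
    show "weight U zs \<longleftrightarrow> (\<exists>ps. zs = map label ps \<and> slide_path ps Y)"
    proof
      assume "weight U zs"
      then obtain ps where z: "z \<in> D" "zs' = map label ps" "slide_path ps (Yf z)"
        using wD[OF zs(2)] zs(1) by blast
      from D1[OF z(1)] obtain q where "z = label q" "q \<in> movable 2 Y" "slide 2 q Y = Yf z" by blast
      then show "\<exists>ps. zs = map label ps \<and> slide_path ps Y"
        using z zs by (intro exI[of _ "q # ps"]) auto
    next
      assume "\<exists>ps. zs = map label ps \<and> slide_path ps Y"
      then obtain p ps where "z = label p" "zs' = map label ps" "p \<in> movable 2 Y" "slide_path ps (slide 2 p Y)"
        using zs by auto
      then show "weight U zs" using wD[OF zs(2)] zs(1) D2 Yfp by auto
    qed
  next
    have "dim U = (\<Sum>z\<in>D. dim (E z))"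
      using dim_eq_sum_eigs[OF normal_wop sU submod_wop[OF subU kn(1)], of "Suc k"] kn
      by (simp add: D_def E_def)
    also have "\<dots> = (\<Sum>p\<in>movable 2 Y. dim (E (label p)))"
      unfolding Deq by (subst sum.reindex) (auto intro: inj_on_subset[OF inj_label])
    also have "\<dots> = (\<Sum>p\<in>movable 2 Y. path_count k (slide 2 p Y))"
      using Yf D2 Yfp by (intro sum.cong) (auto simp: irr_shape_def)
    finally show "dim U = path_count (Suc k) Y" by (simp add: slide_sum_def)
  next
    obtain ps where "slide_path ps (Yf z0)" "length ps = k" using pl[OF z0(1)] by blast
    moreover have "q0 \<in> movable 2 Y" "slide 2 q0 Y = Yf z0"
      using slide_raise[OF z0(3,4)] by (auto simp: Y_def)
    ultimately show "\<exists>ps. slide_path ps Y \<and> length ps = Suc k" by (intro exI[of _ "q0 # ps"]) auto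
  qed
  then show ?thesis ..
qed

lemma irr_shape_exists: "k \<le> n \<Longrightarrow> irr k U \<Longrightarrow> \<exists>Y. irr_shape k U Y"
proof (induction k arbitrary: U)
  case 0
  then show ?case using irr_shape_0 by blast
next
  case (Suc k)
  then show ?case by (intro irr_shape_Suc) auto
qed

text \<open>The operators up to level \<open>k\<close> preserve both \<open>weig (Suc k) e\<close>
  and its complement, so each eigenvalue equation for \<open>x + y\<close> splits into one for
  \<open>x\<close> and one for \<open>y\<close>.\<close>

lemma wspace_component:
  assumes "k < n" "length zs \<le> k" "x \<in> weig (Suc k) e" "y \<in> other_eigs (wop (Suc k)) e"
    and "x + y \<in> wspace zs"
  shows "x \<in> wspace zs"
  using assms(2,5)
proof (induction zs)
  case (Cons z zs)
  let ?j = "Suc (length zs)" and ?E = "weig (Suc k) e" and ?F = "other_eigs (wop (Suc k)) e"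
  have kn: "k \<le> n" using assms(1) by simp
  have l: "lin (wop ?j)" using normal_wop[of ?j] normal_op_linear Cons.prems assms(1) by simp
  have N: "normal_op (wop (Suc k))" using normal_wop assms(1) by simp
  note S = subspace_eig[OF normal_op_linear[OF N]] subspace_other_eigs
  have "wop ?j x \<in> ?E" "wop ?j y \<in> ?F"
    using submod_wop[OF submod_weig(1)[OF assms(1)] kn] submod_wop[OF submod_weig(2)[OF assms(1)] kn]
      assms(3,4) Cons.prems by auto
  then have E: "wop ?j x - z *s x \<in> ?E" and F: "z *s y - wop ?j y \<in> ?F"
    using assms(3,4) S by (auto intro!: subspace_diff subspace_scale)
  have "wop ?j (x + y) = z *s (x + y)" using Cons.prems by (simp add: eig_def)
  then have "wop ?j x - z *s x = z *s y - wop ?j y"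
    by (simp add: lin_simps[OF l] scale_right_distrib algebra_simps)
  with F have "wop ?j x - z *s x \<in> ?F" by simp
  then have "wop ?j x - z *s x = 0" by (rule eig_Int_other_eigs[OF N E])
  then have "x \<in> weig ?j z" by (simp add: eig_def)
  then show ?case using Cons by simp
qed simp

section \<open>The odd-dimensional constituent\<close>

theorem unique_odd_irr:
  assumes k: "k < n" and V: "irr (Suc k) UNIV" and odd: "odd (dim UNIV)"
  shows "\<exists>!W. irr k W \<and> odd (dim W)"
proof -
  have kn: "Suc k \<le> n" "k \<le> n" using k by auto
  obtain Y where Y: "irr_shape (Suc k) UNIV Y" using irr_shape_exists[OF kn(1) V] by blast
  then have "odd (path_count (Suc k) Y)" using odd by (simp add: irr_shape_def)
  from unique_odd_slide[OF this] obtain p where p: "p \<in> movable 2 Y" "odd (path_count k (slide 2 p Y))"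
    and pu: "\<And>q. q \<in> movable 2 Y \<Longrightarrow> odd (path_count k (slide 2 q Y)) \<Longrightarrow> q = p" by blast
  let ?W = "weig (Suc k) (label p)"
  obtain ps0 where "slide_path ps0 Y" "length ps0 = Suc k" using Y by (auto simp: irr_shape_def)
  then obtain ps where ps: "slide_path (p # ps) Y" "length ps = k"
    using slide_path_last[OF _ p(1)] by (metis Suc_inject)
  then have "weight UNIV (label p # map label ps)" using weight_iff_label[OF Y, of "p # ps"] by simp
  then have w: "weight ?W (map label ps)" using ps(2) by (simp add: weight_Cons)
  then have "?W \<noteq> {0}" by (auto simp: weight_def)
  then have irrW: "irr k ?W" using irr_weig[OF k V, of "label p"] by simp
  then obtain Yp where Yp: "irr_shape k ?W Yp" using irr_shape_exists kn by blast
  then have "slide_path ps Yp" using w ps(2) weight_iff_label by blast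
  then have "Yp = slide 2 p Y" using slide_path_unique ps(1) by simp
  then have oddW: "odd (dim ?W)" using Yp p(2) by (simp add: irr_shape_def)
  have "W = ?W" if W: "irr k W" "odd (dim W)" for W
  proof -
    obtain YW where YW: "irr_shape k W YW" using irr_shape_exists kn W by blast
    have sub: "submod k W" using W by (simp add: irr_def)
    \<comment> \<open>If \<open>W\<close> had components for \<open>e \<noteq> label p\<close>, the
      \<open>e\<close>-component of a weight vector of \<open>W\<close> would extend its weight by
      \<open>e\<close>. So \<open>W\<close> would have the diagram of \<open>Y\<close> with some box
      \<open>q\<close> removed, where \<open>e = label q\<close>; its odd dimension then forces
      \<open>q = p\<close>.\<close>
    have "W \<subseteq> other_eigs (wop (Suc k)) e" if e: "e \<noteq> label p" for e
    proof (rule ccontr)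
      let ?F = "other_eigs (wop (Suc k)) e"
      assume "\<not> W \<subseteq> ?F"
      moreover have "submod k (W \<inter> ?F)" using sub submod_weig(2)[OF k] by (rule submod_Int)
      ultimately have WF: "W \<inter> ?F = {0}" using W(1) unfolding irr_def by blast
      obtain qs where qs: "slide_path qs YW" "length qs = k" using YW by (auto simp: irr_shape_def)
      then have "weight W (map label qs)" using weight_iff_label[OF YW] by blast
      then obtain w where w: "w \<in> W" "w \<noteq> 0" "w \<in> wspace (map label qs)" by (auto simp: weight_def)
      have N: "normal_op (wop (Suc k))" using normal_wop kn by simp
      have "w \<in> span (\<Union>z. UNIV \<inter> weig (Suc k) z)" using normal_op_span[OF N subspace_UNIV] by blast
      then obtain x y where xy: "w = x + y" "x \<in> weig (Suc k) e" "y \<in> ?F"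
        using span_eigs_split[OF N subspace_UNIV] by blast
      have "x \<noteq> 0"
      proof
        assume "x = 0"
        then have "w \<in> W \<inter> ?F" using xy w(1) by simp
        then show False using WF w(2) by blast
      qed
      moreover have "x \<in> wspace (map label qs)"
        using wspace_component[OF k _ xy(2,3)] qs(2) w(3) xy(1) by simp
      ultimately have we: "weight UNIV (e # map label qs)"
        using xy(2) qs(2) by (auto simp: weight_def)
      have len: "length (e # map label qs) = Suc k" using qs(2) by simp
      then obtain rs where rs: "e # map label qs = map label rs" "slide_path rs Y"
        using iffD1[OF Y[unfolded irr_shape_def, THEN conjunct1, rule_format, OF len] we] by (elim exE conjE)
      then obtain q qs' where "rs = q # qs'" "e = label q" "map label qs = map label qs'"
        by (cases rs) auto
      then have q: "rs = q # qs" "e = label q" using inj_map_eq_map[OF inj_label] by auto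
      then have "YW = slide 2 q Y" using slide_path_unique[OF qs(1)] rs(2) by simp
      then have "odd (path_count k (slide 2 q Y))" using YW W(2) by (simp add: irr_shape_def)
      then have "q = p" using pu rs(2) q(1) by simp
      then show False using e q(2) by simp
    qed
    then have "W \<subseteq> ?W"
      using other_eigs_all_imp_eig[OF normal_wop[of "Suc k"]] kn by (meson subsetD subsetI zero_less_Suc)
    then show "W = ?W" using irrW W(1) unfolding irr_def by blast
  qed
  then show ?thesis using irrW oddW by blast
qed

end

section \<open>Representations of hyperoctahedral groups\<close>

lemma hom_general_linear:
  assumes "\<rho> \<in> hom G (general_linear scale)" "group G"
  shows "g \<in> carrier G \<Longrightarrow> Vector_Spaces.linear scale scale (\<rho> g)"
    and "g \<in> carrier G \<Longrightarrow> h \<in> carrier G \<Longrightarrow> \<rho> (g \<otimes>\<^bsub>G\<^esub> h) = \<rho> g \<circ> \<rho> h"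
    and "\<rho> \<one>\<^bsub>G\<^esub> = id"
proof -
  interpret group G by fact
  show "g \<in> carrier G \<Longrightarrow> Vector_Spaces.linear scale scale (\<rho> g)"
    and m: "g \<in> carrier G \<Longrightarrow> h \<in> carrier G \<Longrightarrow> \<rho> (g \<otimes>\<^bsub>G\<^esub> h) = \<rho> g \<circ> \<rho> h" for g h
    using assms(1) by (auto simp: hom_def general_linear_def)
  have "bij (\<rho> \<one>\<^bsub>G\<^esub>)" using assms(1) by (auto simp: hom_def general_linear_def)
  \<comment> \<open>An idempotent bijection is the identity.\<close>
  moreover have "\<rho> \<one>\<^bsub>G\<^esub> \<circ> \<rho> \<one>\<^bsub>G\<^esub> = \<rho> \<one>\<^bsub>G\<^esub>" using m[of "\<one>\<^bsub>G\<^esub>" "\<one>\<^bsub>G\<^esub>"] by simp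
  ultimately show "\<rho> \<one>\<^bsub>G\<^esub> = id" by (metis bij_is_inj comp_id fun.inj_map_strong inj_compose inv_o_cancel o_assoc id_o)
qed

text \<open>The standard form in coordinates is summed over the finite group. Its values
  \<open>ip u u\<close> are sums of squares, and translation by \<open>h\<close> only reindexes the
  sum.\<close>

lemma ex_invariant_hermitian_form:
  assumes "finite_dimensional_vector_space scale B" "\<rho> \<in> hom G (general_linear scale)"
    and "group G" "finite (carrier G)"
  shows "\<exists>ip. hermitian_space scale B ip \<and> (\<forall>g\<in>carrier G. \<forall>u v. ip (\<rho> g u) (\<rho> g v) = ip u v)"
proof -
  interpret finite_dimensional_vector_space scale B by fact
  interpret group G by fact
  note hom = hom_general_linear[OF assms(2,3)]
  define r where "r = representation B"
  have r_add: "r (u + v) b = r u b + r v b" for u v b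
    by (simp add: r_def representation_add independent_Basis span_Basis)
  have r_scale: "r (scale c u) b = c * r u b" for c u b
    by (simp add: r_def representation_scale independent_Basis span_Basis)
  have lin: "\<rho> g (u + v) = \<rho> g u + \<rho> g v" "\<rho> g (scale c u) = scale c (\<rho> g u)" if "g \<in> carrier G" for g u v c
    using hom(1)[OF that] by (auto simp: Vector_Spaces.linear_iff)
  define ip where "ip = (\<lambda>u v. \<Sum>g\<in>carrier G. \<Sum>b\<in>B. r (\<rho> g u) b * cnj (r (\<rho> g v) b))"
  have "hermitian_space scale B ip"
  proof unfold_locales
    show "ip (u + v) w = ip u w + ip v w" for u v w
      by (simp add: ip_def lin r_add distrib_right sum.distrib)
    show "ip (scale c u) v = c * ip u v" for c u v
      by (simp add: ip_def lin r_scale sum_distrib_left mult.assoc)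
    show "ip v u = cnj (ip u v)" for u v
      by (simp add: ip_def mult.commute)
    fix u assume "ip u u = 0"
    moreover have "ip u u = complex_of_real (\<Sum>g\<in>carrier G. \<Sum>b\<in>B. (cmod (r (\<rho> g u) b))\<^sup>2)"
      by (simp add: ip_def complex_norm_square[symmetric] del: of_real_power)
    ultimately have "(\<Sum>g\<in>carrier G. \<Sum>b\<in>B. (cmod (r (\<rho> g u) b))\<^sup>2) = 0"
      by (metis of_real_eq_0_iff)
    then have "\<forall>g\<in>carrier G. (\<Sum>b\<in>B. (cmod (r (\<rho> g u) b))\<^sup>2) = 0"
      using assms(4) by (subst (asm) sum_nonneg_eq_0_iff) (auto intro: sum_nonneg)
    then have "(\<Sum>b\<in>B. (cmod (r (\<rho> \<one>\<^bsub>G\<^esub> u) b))\<^sup>2) = 0" by simp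
    then have "\<forall>b\<in>B. r u b = 0"
      using finite_Basis by (subst (asm) sum_nonneg_eq_0_iff) (auto simp: hom(3))
    moreover have "(\<Sum>b\<in>B. scale (r u b) b) = u"
      unfolding r_def using finite_Basis
      by (intro sum_representation_eq) (auto simp: independent_Basis span_Basis)
    ultimately show "u = 0" by (metis (no_types, lifting) scale_zero_left sum.neutral)
  qed
  moreover have "ip (\<rho> h u) (\<rho> h v) = ip u v" if h: "h \<in> carrier G" for h u v
    unfolding ip_def
    by (rule sum.reindex_bij_witness[where i = "\<lambda>g. g \<otimes>\<^bsub>G\<^esub> inv\<^bsub>G\<^esub> h" and j = "\<lambda>g. g \<otimes>\<^bsub>G\<^esub> h"])
      (use h in \<open>auto simp: hom(2) m_assoc\<close>)
  ultimately show ?thesis by blast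
qed

section \<open>Generators, relations and double cosets\<close>

definition sign_flip :: "nat \<Rightarrow> (nat \<Rightarrow> nat \<Rightarrow> nat) \<times> (nat \<Rightarrow> nat)" where
  "sign_flip k = (\<lambda>i. if i = k then transpose 1 2 else id, id)"

definition adj_swap :: "nat \<Rightarrow> (nat \<Rightarrow> nat \<Rightarrow> nat) \<times> (nat \<Rightarrow> nat)" where
  "adj_swap k = (\<lambda>i. id, transpose k (Suc k))"

lemma hyperoctahedral_carrier:
  "(f, p) \<in> carrier (hyperoctahedral n) \<longleftrightarrow>
     (\<forall>i\<in>{1..n}. f i permutes {1..2}) \<and> (\<forall>i. i \<notin> {1..n} \<longrightarrow> f i = id) \<and> p permutes {1..n}"
  by (auto simp: hyperoctahedral_def wreath_sym_def sym_group_def)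

lemma hyperoctahedral_mult:
  "(f, p) \<otimes>\<^bsub>hyperoctahedral n\<^esub> (g, q) = (\<lambda>i. f i \<circ> g (inv_into UNIV p i), p \<circ> q)"
  by (simp add: hyperoctahedral_def wreath_sym_def sym_group_def)

lemma hyperoctahedral_one: "\<one>\<^bsub>hyperoctahedral n\<^esub> = (\<lambda>i. id, id)"
  by (simp add: hyperoctahedral_def wreath_sym_def sym_group_def)

lemma hyperoctahedral_carrier_mono:
  "m \<le> n \<Longrightarrow> carrier (hyperoctahedral m) \<subseteq> carrier (hyperoctahedral n)"
  using subgroup_hyperoctahedral(1) by (rule subgroup.subset)

lemma finite_hyperoctahedral: "finite (carrier (hyperoctahedral n))"
proof -
  have "carrier (hyperoctahedral n) \<subseteq>
    {f. \<forall>i. (i \<in> {1..n} \<longrightarrow> f i \<in> {q. q permutes {1..2}}) \<and> (i \<notin> {1..n} \<longrightarrow> f i = id)} \<times> {p. p permutes {1..n}}"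
    by (auto simp: hyperoctahedral_carrier)
  moreover have "finite \<dots>"
    by (intro finite_cartesian_product finite_set_of_finite_funs finite_permutations) auto
  ultimately show ?thesis by (rule finite_subset)
qed

lemma sign_flip_carrier: "0 < k \<Longrightarrow> k \<le> n \<Longrightarrow> sign_flip k \<in> carrier (hyperoctahedral n)"
  by (auto simp: sign_flip_def hyperoctahedral_carrier permutes_id intro: permutes_swap_id)

lemma adj_swap_carrier: "0 < k \<Longrightarrow> k < n \<Longrightarrow> adj_swap k \<in> carrier (hyperoctahedral n)"
  by (auto simp: adj_swap_def hyperoctahedral_carrier permutes_id intro: permutes_swap_id)

lemma inv_transpose: "inv_into UNIV (transpose a b) = transpose a b"
  by (rule inv_unique_comp) simp_all

lemma sign_flip_mult_left:
  "sign_flip k \<otimes>\<^bsub>hyperoctahedral n\<^esub> (g, q) = (\<lambda>i. if i = k then transpose 1 2 \<circ> g i else g i, q)"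
  by (auto simp: sign_flip_def hyperoctahedral_mult)

lemma sign_flip_mult_self: "sign_flip k \<otimes>\<^bsub>hyperoctahedral n\<^esub> sign_flip k = (\<lambda>i. id, id)"
  by (auto simp: sign_flip_def hyperoctahedral_mult)

lemma adj_swap_mult_left:
  "adj_swap k \<otimes>\<^bsub>hyperoctahedral n\<^esub> (g, q) = (\<lambda>i. g (transpose k (Suc k) i), transpose k (Suc k) \<circ> q)"
  by (simp add: adj_swap_def hyperoctahedral_mult inv_transpose)

lemma adj_swap_mult_self: "adj_swap k \<otimes>\<^bsub>hyperoctahedral n\<^esub> adj_swap k = (\<lambda>i. id, id)"
  by (simp add: adj_swap_def hyperoctahedral_mult)

lemma adj_swap_sign_flip:
  "adj_swap k \<otimes>\<^bsub>hyperoctahedral n\<^esub> sign_flip k = sign_flip (Suc k) \<otimes>\<^bsub>hyperoctahedral n\<^esub> adj_swap k"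
  by (auto simp: adj_swap_def sign_flip_def hyperoctahedral_mult inv_transpose fun_eq_iff transpose_def)

lemma adj_swap_braid:
  "adj_swap k \<otimes>\<^bsub>hyperoctahedral n\<^esub> (adj_swap (Suc k) \<otimes>\<^bsub>hyperoctahedral n\<^esub> adj_swap k) =
   adj_swap (Suc k) \<otimes>\<^bsub>hyperoctahedral n\<^esub> (adj_swap k \<otimes>\<^bsub>hyperoctahedral n\<^esub> adj_swap (Suc k))"
  by (simp add: adj_swap_def hyperoctahedral_mult) (auto simp: fun_eq_iff transpose_def)

lemma adj_swap_commute:
  assumes "g \<in> carrier (hyperoctahedral k)"
  shows "adj_swap (Suc k) \<otimes>\<^bsub>hyperoctahedral n\<^esub> g = g \<otimes>\<^bsub>hyperoctahedral n\<^esub> adj_swap (Suc k)"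
proof -
  obtain f p where g: "g = (f, p)" by (cases g)
  have f: "f i = id" if "i \<notin> {1..k}" for i using assms that by (auto simp: g hyperoctahedral_carrier)
  have p: "p permutes {1..k}" using assms by (simp add: g hyperoctahedral_carrier)
  let ?s = "transpose (Suc k) (Suc (Suc k))"
  have "f (?s i) = f i" for i using f by (auto simp: transpose_def)
  moreover have "?s (p x) = p (?s x)" for x
  proof (cases "x \<in> {1..k}")
    case True
    then have "p x \<in> {1..k}" using permutes_in_image[OF p] by blast
    then show ?thesis using True by (auto simp: transpose_def)
  next
    case False
    then have "?s x \<notin> {1..k}" by (auto simp: transpose_def)
    then show ?thesis using False permutes_not_in[OF p] by metis
  qed
  ultimately show ?thesis
    unfolding g adj_swap_mult_left by (auto simp: adj_swap_def hyperoctahedral_mult)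
qed

lemma sign_flip_commute:
  assumes "g \<in> carrier (hyperoctahedral k)"
  shows "sign_flip (Suc k) \<otimes>\<^bsub>hyperoctahedral n\<^esub> g = g \<otimes>\<^bsub>hyperoctahedral n\<^esub> sign_flip (Suc k)"
proof -
  obtain f p where g: "g = (f, p)" by (cases g)
  have f: "f (Suc k) = id" using assms by (auto simp: g hyperoctahedral_carrier)
  have p: "p permutes {1..k}" using assms by (simp add: g hyperoctahedral_carrier)
  have "p (Suc k) = Suc k" by (rule permutes_not_in[OF p]) simp
  then have "inv_into UNIV p i = Suc k \<longleftrightarrow> i = Suc k" for i
    using permutes_inv_eq[OF p] by auto
  then show ?thesis
    unfolding g sign_flip_mult_left using f by (auto simp: sign_flip_def hyperoctahedral_mult fun_eq_iff)
qed

lemma permutes_two: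
  assumes "p permutes {1..2::nat}"
  shows "p = id \<or> p = transpose 1 2"
proof -
  have "{1..2::nat} = {1, 2}" by auto
  then show ?thesis using assms permutes_doubleton_iff by metis
qed

text \<open>A flip on the left clears the sign at \<open>Suc k\<close>. If the permutation
  \<open>p\<close> moves \<open>Suc k\<close>, its image is some \<open>j \<le> k\<close>;
  exchanging \<open>j\<close> with \<open>k\<close> and then \<open>k\<close> with
  \<open>Suc k\<close> brings it back. So \<open>p\<close> is a single \<open>adj_swap k\<close>
  between two permutations of the smaller group, and all remaining signs go into the left
  factor.\<close>

lemma hyperoctahedral_decompose:
  assumes x: "x \<in> carrier (hyperoctahedral (Suc k))"
  obtains y where "x = y \<or> x = sign_flip (Suc k) \<otimes>\<^bsub>hyperoctahedral n\<^esub> y"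
    and "y \<in> carrier (hyperoctahedral k) \<or> 0 < k \<and>
      (\<exists>h\<in>carrier (hyperoctahedral k). \<exists>h'\<in>carrier (hyperoctahedral k).
        y = h \<otimes>\<^bsub>hyperoctahedral n\<^esub> adj_swap k \<otimes>\<^bsub>hyperoctahedral n\<^esub> h')"
proof -
  obtain f p where xf: "x = (f, p)" by (cases x)
  have f: "\<And>i. i \<in> {1..Suc k} \<Longrightarrow> f i permutes {1..2}" "\<And>i. i \<notin> {1..Suc k} \<Longrightarrow> f i = id"
    and p: "p permutes {1..Suc k}"
    using x by (auto simp: xf hyperoctahedral_carrier)
  have restr: "q permutes {1..k}" if "q permutes {1..Suc k}" "q (Suc k) = Suc k" for q
    using that by (intro permutes_superset[OF that(1)]) (auto simp: le_Suc_eq)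
  define f' where "f' = f(Suc k := id)"
  have f': "(f', q) \<in> carrier (hyperoctahedral k)" if "q permutes {1..k}" for q
    using f that by (auto simp: hyperoctahedral_carrier f'_def)
  have "f (Suc k) = id \<or> f (Suc k) = transpose 1 2" using f(1)[of "Suc k"] permutes_two by simp
  then have "x = (f', p) \<or> x = sign_flip (Suc k) \<otimes>\<^bsub>hyperoctahedral n\<^esub> (f', p)"
    unfolding xf sign_flip_mult_left by (auto simp: f'_def fun_eq_iff)
  moreover have "(f', p) \<in> carrier (hyperoctahedral k) \<or> 0 < k \<and>
      (\<exists>h\<in>carrier (hyperoctahedral k). \<exists>h'\<in>carrier (hyperoctahedral k).
        (f', p) = h \<otimes>\<^bsub>hyperoctahedral n\<^esub> adj_swap k \<otimes>\<^bsub>hyperoctahedral n\<^esub> h')"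
  proof (cases "p (Suc k) = Suc k")
    case True
    then show ?thesis using f' restr p by blast
  next
    case False
    have "p (Suc k) \<in> {1..Suc k}" using permutes_in_image[OF p, of "Suc k"] by simp
    with False have j: "p (Suc k) \<in> {1..k}" by auto
    then have k0: "0 < k" by auto
    define a where "a = transpose (p (Suc k)) k"
    define b where "b = transpose k (Suc k)"
    have a: "a permutes {1..k}" unfolding a_def using j k0 by (intro permutes_swap_id) auto
    have b: "b permutes {1..Suc k}" unfolding b_def using k0 by (intro permutes_swap_id) auto
    have "(b \<circ> (a \<circ> p)) permutes {1..Suc k}"
      using p a b by (intro permutes_compose permutes_subset[OF a]) auto
    moreover have "(b \<circ> (a \<circ> p)) (Suc k) = Suc k" by (simp add: a_def b_def)
    ultimately have c: "(b \<circ> (a \<circ> p)) permutes {1..k}" by (rule restr)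
    have "a \<circ> a = id" "b \<circ> b = id" by (simp_all add: a_def b_def)
    then have "a \<circ> b \<circ> (b \<circ> (a \<circ> p)) = p" by (metis comp_assoc id_o)
    then have "(f', p) = (f', a) \<otimes>\<^bsub>hyperoctahedral n\<^esub> adj_swap k \<otimes>\<^bsub>hyperoctahedral n\<^esub> (\<lambda>_. id, b \<circ> (a \<circ> p))"
      by (simp add: adj_swap_def hyperoctahedral_mult b_def[symmetric])
    moreover have "(\<lambda>_. id, b \<circ> (a \<circ> p)) \<in> carrier (hyperoctahedral k)"
      using c by (simp add: hyperoctahedral_carrier permutes_id)
    ultimately show ?thesis using f'[OF a] k0 by blast
  qed
  ultimately show thesis by (rule that)
qed

lemma hyperoctahedral_tower_representation:
  assumes \<rho>: "\<rho> \<in> hom (hyperoctahedral n) (general_linear scale)"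
    and ip: "hermitian_space scale B ip"
    and inv: "\<And>g u v. g \<in> carrier (hyperoctahedral n) \<Longrightarrow> ip (\<rho> g u) (\<rho> g v) = ip u v"
  shows "hyperoctahedral_tower scale B ip n (\<lambda>k. \<rho> ` carrier (hyperoctahedral k))
    (\<lambda>k. \<rho> (adj_swap k)) (\<lambda>k. \<rho> (sign_flip k))"
proof -
  let ?H = "hyperoctahedral n"
  interpret hermitian_space scale B ip by fact
  note hom = hom_general_linear[OF \<rho> group_hyperoctahedral]
  have mult: "\<rho> g (\<rho> h v) = \<rho> (g \<otimes>\<^bsub>?H\<^esub> h) v" if "g \<in> carrier ?H" "h \<in> carrier ?H" for g h v
    using hom(2)[OF that] by simp
  have closed: "g \<otimes>\<^bsub>?H\<^esub> h \<in> carrier (hyperoctahedral k)"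
    if "k \<le> n" "g \<in> carrier (hyperoctahedral k)" "h \<in> carrier (hyperoctahedral k)" for k g h
    using subgroup.m_closed[OF subgroup_hyperoctahedral(1)[OF that(1)] that(2,3)] .
  have one: "\<rho> (\<lambda>i. id, id) = id" using hom(3) by (simp add: hyperoctahedral_one)
  have sub: "g \<in> carrier ?H" if "g \<in> carrier (hyperoctahedral k)" "k \<le> n" for g k
    using hyperoctahedral_carrier_mono that by blast
  \<comment> \<open>An involution that preserves the form is self-adjoint.\<close>
  have selfadjoint: "ip (\<rho> g u) v = ip u (\<rho> g v)"
    if "g \<in> carrier ?H" "g \<otimes>\<^bsub>?H\<^esub> g = (\<lambda>i. id, id)" for g u v
    using inv[OF that(1), of u "\<rho> g v"] by (simp add: mult that one)
  show ?thesis
  proof (intro hyperoctahedral_tower.intro hyperoctahedral_tower_axioms.intro ip)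
    fix k g assume "k \<le> n" "g \<in> \<rho> ` carrier (hyperoctahedral k)"
    then show "lin g" using hom(1) sub by blast
  next
    have "carrier (hyperoctahedral 0) = {(\<lambda>i. id, id)}"
      by (auto simp: hyperoctahedral_carrier)
    then show "\<rho> ` carrier (hyperoctahedral 0) = {id}" by (simp add: one)
  next
    fix k g h assume k: "k \<le> n" and "g \<in> \<rho> ` carrier (hyperoctahedral k)" "h \<in> \<rho> ` carrier (hyperoctahedral k)"
    then obtain x y where xy: "x \<in> carrier (hyperoctahedral k)" "y \<in> carrier (hyperoctahedral k)"
      "g = \<rho> x" "h = \<rho> y" by blast
    then have "g \<circ> h = \<rho> (x \<otimes>\<^bsub>?H\<^esub> y)" using hom(2)[OF sub[OF xy(1) k] sub[OF xy(2) k]] by simp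
    then show "g \<circ> h \<in> \<rho> ` carrier (hyperoctahedral k)" using closed[OF k xy(1,2)] by simp
  next
    fix k assume "k < n"
    then show "\<rho> ` carrier (hyperoctahedral k) \<subseteq> \<rho> ` carrier (hyperoctahedral (Suc k))"
      using hyperoctahedral_carrier_mono[of k "Suc k"] by auto
    show "\<rho> (sign_flip (Suc k)) \<in> \<rho> ` carrier (hyperoctahedral (Suc k))"
      using sign_flip_carrier by blast
  next
    fix k assume "0 < k" "k < n"
    then show "\<rho> (adj_swap k) \<in> \<rho> ` carrier (hyperoctahedral (Suc k))"
      using adj_swap_carrier by blast
  next
    fix k g assume k: "k < n" and "g \<in> \<rho> ` carrier (hyperoctahedral (Suc k))"
    then obtain x where x: "x \<in> carrier (hyperoctahedral (Suc k))" "g = \<rho> x" by blast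
    obtain y where y: "x = y \<or> x = sign_flip (Suc k) \<otimes>\<^bsub>?H\<^esub> y"
      "y \<in> carrier (hyperoctahedral k) \<or> 0 < k \<and>
      (\<exists>h\<in>carrier (hyperoctahedral k). \<exists>h'\<in>carrier (hyperoctahedral k). y = h \<otimes>\<^bsub>?H\<^esub> adj_swap k \<otimes>\<^bsub>?H\<^esub> h')"
      using hyperoctahedral_decompose[OF x(1)] .
    have fl: "sign_flip (Suc k) \<in> carrier ?H" using sign_flip_carrier k by simp
    have sub': "h \<in> carrier (hyperoctahedral k) \<Longrightarrow> h \<in> carrier ?H" for h using sub k by simp
    from y(2) show "\<exists>h h'. h \<in> \<rho> ` carrier (hyperoctahedral k) \<and> h' \<in> \<rho> ` carrier (hyperoctahedral k) \<and>
      (g = h \<or> g = \<rho> (sign_flip (Suc k)) \<circ> h \<or> 0 < k \<and>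
        (g = h \<circ> \<rho> (adj_swap k) \<circ> h' \<or> g = \<rho> (sign_flip (Suc k)) \<circ> (h \<circ> \<rho> (adj_swap k) \<circ> h')))"
    proof
      assume yk: "y \<in> carrier (hyperoctahedral k)"
      then have "g = \<rho> y \<or> g = \<rho> (sign_flip (Suc k)) \<circ> \<rho> y"
        using y(1) x(2) hom(2)[OF fl sub'[OF yk]] by auto
      then show ?thesis using yk by blast
    next
      assume "0 < k \<and> (\<exists>h\<in>carrier (hyperoctahedral k). \<exists>h'\<in>carrier (hyperoctahedral k).
        y = h \<otimes>\<^bsub>?H\<^esub> adj_swap k \<otimes>\<^bsub>?H\<^esub> h')"
      then obtain h h' where k0: "0 < k" and h: "h \<in> carrier (hyperoctahedral k)" "h' \<in> carrier (hyperoctahedral k)"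
        and yh: "y = h \<otimes>\<^bsub>?H\<^esub> adj_swap k \<otimes>\<^bsub>?H\<^esub> h'" by blast
      have ad: "adj_swap k \<in> carrier ?H" using adj_swap_carrier k0 k by simp
      have c: "h \<otimes>\<^bsub>?H\<^esub> adj_swap k \<in> carrier ?H" "y \<in> carrier ?H"
        unfolding yh using closed[OF order_refl] sub'[OF h(1)] sub'[OF h(2)] ad by auto
      have "\<rho> y = \<rho> h \<circ> \<rho> (adj_swap k) \<circ> \<rho> h'"
        unfolding yh using hom(2) sub' h ad c(1) by auto
      then have "g = \<rho> h \<circ> \<rho> (adj_swap k) \<circ> \<rho> h' \<or>
          g = \<rho> (sign_flip (Suc k)) \<circ> (\<rho> h \<circ> \<rho> (adj_swap k) \<circ> \<rho> h')"
        using y(1) x(2) hom(2)[OF fl c(2)] by auto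
      then show ?thesis using h k0 by blast
    qed
  next
    fix k u v assume "0 < k" "k < n"
    then show "ip (\<rho> (adj_swap k) u) v = ip u (\<rho> (adj_swap k) v)"
      by (intro selfadjoint adj_swap_carrier adj_swap_mult_self)
  next
    fix k u v assume "0 < k" "k \<le> n"
    then show "ip (\<rho> (sign_flip k) u) v = ip u (\<rho> (sign_flip k) v)"
      by (intro selfadjoint sign_flip_carrier sign_flip_mult_self)
  next
    fix k v assume "0 < k" "k < n"
    then show "\<rho> (adj_swap k) (\<rho> (adj_swap k) v) = v"
      by (simp add: mult adj_swap_carrier adj_swap_mult_self one)
  next
    fix k v assume "0 < k" "k \<le> n"
    then show "\<rho> (sign_flip k) (\<rho> (sign_flip k) v) = v"
      by (simp add: mult sign_flip_carrier sign_flip_mult_self one)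
  next
    fix k v assume "0 < k" "k < n"
    then show "\<rho> (adj_swap k) (\<rho> (sign_flip k) v) = \<rho> (sign_flip (Suc k)) (\<rho> (adj_swap k) v)"
      by (simp add: mult adj_swap_carrier sign_flip_carrier adj_swap_sign_flip)
  next
    fix k v assume "0 < k" "Suc k < n"
    then have "adj_swap k \<in> carrier ?H" "adj_swap (Suc k) \<in> carrier ?H" using adj_swap_carrier by auto
    then show "\<rho> (adj_swap k) (\<rho> (adj_swap (Suc k)) (\<rho> (adj_swap k) v)) =
        \<rho> (adj_swap (Suc k)) (\<rho> (adj_swap k) (\<rho> (adj_swap (Suc k)) v))"
      using closed[OF order_refl] by (simp add: mult adj_swap_braid)
  next
    fix k g v assume k: "Suc k < n" and "g \<in> \<rho> ` carrier (hyperoctahedral k)"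
    then obtain x where x: "x \<in> carrier (hyperoctahedral k)" "g = \<rho> x" by blast
    then have "x \<in> carrier ?H" using sub k by simp
    then show "\<rho> (adj_swap (Suc k)) (g v) = g (\<rho> (adj_swap (Suc k)) v)"
      using k x by (simp add: mult adj_swap_carrier adj_swap_commute[OF x(1)])
  next
    fix k g v assume k: "k < n" and "g \<in> \<rho> ` carrier (hyperoctahedral k)"
    then obtain x where x: "x \<in> carrier (hyperoctahedral k)" "g = \<rho> x" by blast
    then have "x \<in> carrier ?H" using sub k by simp
    then show "\<rho> (sign_flip (Suc k)) (g v) = g (\<rho> (sign_flip (Suc k)) v)"
      using k x by (simp add: mult sign_flip_carrier sign_flip_commute[OF x(1)])
  qed
qed

theorem mainTheorem3:
  fixes n :: nat
    and scale :: "complex \<Rightarrow> 'v::ab_group_add \<Rightarrow> 'v"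
    and \<rho> :: "(nat \<Rightarrow> nat \<Rightarrow> nat) \<times> (nat \<Rightarrow> nat) \<Rightarrow> 'v \<Rightarrow> 'v"
  assumes "n \<ge> 1"
    and "irreducible_representation (hyperoctahedral n) scale \<rho>"
    and "odd_dimensional scale UNIV"
  shows "\<exists>!W. irreducible_subrepresentation (hyperoctahedral (n - 1)) scale \<rho> W \<and>
              odd_dimensional scale W"
proof -
  have rep: "vector_space scale" "\<rho> \<in> hom (hyperoctahedral n) (general_linear scale)"
    and irr: "irreducible_subrepresentation (hyperoctahedral n) scale \<rho> UNIV"
    using assms(2) by (auto simp: irreducible_representation_def complex_representation_def)
  interpret V: vector_space scale by fact
  obtain B where B: "V.independent B" "UNIV \<subseteq> V.span B" "card B = V.dim UNIV"
    using V.basis_exists[of UNIV] by blast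
  \<comment> \<open>An infinite basis would have cardinality 0, which is even.\<close>
  have "finite B" using B(3) assms(3) by (auto simp: odd_dimensional_def intro: ccontr)
  then have fd: "finite_dimensional_vector_space scale B"
    using B by unfold_locales auto
  obtain ip where ip: "hermitian_space scale B ip"
    "\<And>g u v. g \<in> carrier (hyperoctahedral n) \<Longrightarrow> ip (\<rho> g u) (\<rho> g v) = ip u v"
    using ex_invariant_hermitian_form[OF fd rep(2) group_hyperoctahedral finite_hyperoctahedral] by blast
  have tower: "hyperoctahedral_tower scale B ip n (\<lambda>k. \<rho> ` carrier (hyperoctahedral k))
      (\<lambda>k. \<rho> (adj_swap k)) (\<lambda>k. \<rho> (sign_flip k))"
    by (rule hyperoctahedral_tower_representation[OF rep(2) ip(1)]) (rule ip(2))
  interpret T: hyperoctahedral_tower scale B ip n "\<lambda>k. \<rho> ` carrier (hyperoctahedral k)"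
    "\<lambda>k. \<rho> (adj_swap k)" "\<lambda>k. \<rho> (sign_flip k)"
    by (fact tower)
  have submod: "T.submod k W \<longleftrightarrow> subrepresentation (hyperoctahedral k) scale \<rho> W" for k W
    by (auto simp: T.submod_def subrepresentation_def)
  have irr_iff: "T.irr k W \<longleftrightarrow> irreducible_subrepresentation (hyperoctahedral k) scale \<rho> W" for k W
    unfolding T.irr_def irreducible_subrepresentation_def submod by blast
  have "n - 1 < n" "Suc (n - 1) = n" using assms(1) by auto
  then show ?thesis
    using T.unique_odd_irr[of "n - 1"] irr assms(3) by (simp add: irr_iff odd_dimensional_def)
qed

end
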